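(* Let $\psi$ be a fast majorant, and let $\Omega_{2}$ be an $\mathscr{L}_{\psi}$-extension domain of $\mathbb{R}^{n}$, where $n\geq2$. If $u$ is a real-valued harmonic function in $\Omega_{2}$, then the following statements are equivalent. ($\mathscr{F}_{1}$) $u\in\mathscr{L}_{\psi}(\Omega_{2})$; ($\mathscr{F}_{2}$) there is a positive constant $C$ such that $|\nabla u(x)|\leq C\,\dfrac{\psi(d_{\Omega_{2}}(x))}{d_{\Omega_{2}}(x)}$ for all $x\in\Omega_{2}$; ($\mathscr{F}_{3}$) $|u|\in\mathscr{L}_{\psi}(\Omega_{2})$; ($\mathscr{F}_{4}$) $|u|\in\mathscr{L}_{\psi}(\Omega_{2},\partial\Omega_{2})$; ($\mathscr{F}_{5}$) for a given $p$, where $p\geq\frac{n-2}{n-1}$ if $n>2$ and $p>0$ if $n=2$, there is a positive constant $C$ such that $\tilde{I}_{u,p}(x)\leq C\,\dfrac{\psi(d_{\Omega_{2}}(x))}{d_{\Omega_{2}}(x)}$ for all $x\in\Omega_{2}$.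
   Context: Majorants: a continuous increasing function $\psi:[0,\infty)\to[0,\infty)$ with $\psi(0)=0$ is a majorant if $\psi(t)/t$ is non-increasing for $t>0$. A majorant $\psi$ is fast if there are $\delta_0>0$ and $C>0$ such that $\int_0^\delta\frac{\psi(t)}{t}dt\leq C\psi(\delta)$ for all $0<\delta<\delta_0$. Lipschitz spaces: let $D$ be a proper subdomain of $\mathbb{R}^n$ and $d_D(x)$ the Euclidean distance from $x$ to $\partial D$. A function $F:D\to\mathbb{C}$ (or $\mathbb{R}$) belongs to $\mathscr{L}_\psi(D)$ if there is a constant $C=C(F)>0$ with $|F(x)-F(y)|\leq C\psi(|x-y|)$ for all $x,y\in D$. It belongs to $\mathrm{loc}\mathscr{L}_\psi(D)$ if this inequality holds, with a fixed positive constant $C$, whenever $x\in D$ and $|x-y|<\frac12 d_D(x)$. $D$ is an $\mathscr{L}_\psi$-extension domain if $\mathscr{L}_\psi(D)=\mathrm{loc}\mathscr{L}_\psi(D)$. For sets $E_1,E_2$, $\mathscr{L}_\psi(E_1,E_2)$ is the class of continuous functions $F$ on $E_1\cup E_2$ satisfying $|F(x)-F(y)|\leq C\psi(|x-y|)$, with some constant $C=C(F)>0$, whenever $x\in E_1$ and $y\in E_2$. Means: with $\mathbf{B}^n(x,r)$ the open Euclidean ball in $\mathbb{R}^n$, $|\cdot|$ of a set its Lebesgue measure and $d\mu$ Lebesgue measure, $$\tilde{I}_{u,p}(x)=\left(\frac{1}{|\mathbf{B}^n(x,d_{\Omega_2}(x)/2)|}\int_{\mathbf{B}^n(x,d_{\Omega_2}(x)/2)}|\nabla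 u(y)|^p\,d\mu(y)\right)^{1/p}.$$ *)

theory Defs
  imports "HOL-Analysis.Analysis"
begin

text \<open>A domain is a nonempty connected open set. Functions given only on a subset are represented
  by total functions; on a proper subdomain, every notion below depends only on the values there.\<close>

definition proper_subdomain :: "'a::euclidean_space set \<Rightarrow> bool" where
  "proper_subdomain D \<longleftrightarrow> open D \<and> connected D \<and> D \<noteq> {} \<and> D \<noteq> UNIV"

text \<open>``Increasing'' is taken in the weak sense, so strictly increasing functions are covered.\<close>

definition majorant :: "(real \<Rightarrow> real) \<Rightarrow> bool" where
  "majorant \<psi> \<longleftrightarrow>
     continuous_on {0..} \<psi> \<and> mono_on {0..} \<psi> \<and> \<psi> ` {0..} \<subseteq> {0..} \<and> \<psi> 0 = 0 \<and>
     antimono_on {0<..} (\<lambda>t. \<psi> t / t)"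

text \<open>Integrability is explicit because the Bochner integral of a non-integrable function is 0;
  the integrand is nonnegative, so this says that the integral is finite.\<close>

definition fast_majorant :: "(real \<Rightarrow> real) \<Rightarrow> bool" where
  "fast_majorant \<psi> \<longleftrightarrow> majorant \<psi> \<and>
     (\<exists>\<delta>\<^sub>0>0. \<exists>C>0. \<forall>\<delta>. 0 < \<delta> \<and> \<delta> < \<delta>\<^sub>0 \<longrightarrow>
        set_integrable lborel {0<..<\<delta>} (\<lambda>t. \<psi> t / t) \<and>
        (LINT t:{0<..<\<delta>}|lborel. \<psi> t / t) \<le> C * \<psi> \<delta>)"

definition bdist :: "'a::euclidean_space set \<Rightarrow> 'a \<Rightarrow> real" where
  "bdist D x = infdist x (frontier D)"

definition Lip :: "(real \<Rightarrow> real) \<Rightarrow> 'a::euclidean_space set \<Rightarrow> ('a \<Rightarrow> 'b::real_normed_vector) set" where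
  "Lip \<psi> D = {F. \<exists>C>0. \<forall>x\<in>D. \<forall>y\<in>D. norm (F x - F y) \<le> C * \<psi> (dist x y)}"

text \<open>For a proper subdomain \<open>D\<close>, the condition on \<open>y\<close> already implies \<open>y \<in> D\<close>.\<close>

definition locLip :: "(real \<Rightarrow> real) \<Rightarrow> 'a::euclidean_space set \<Rightarrow> ('a \<Rightarrow> 'b::real_normed_vector) set" where
  "locLip \<psi> D =
     {F. \<exists>C>0. \<forall>x\<in>D. \<forall>y. dist x y < bdist D x / 2 \<longrightarrow> norm (F x - F y) \<le> C * \<psi> (dist x y)}"

text \<open>The two spaces are compared for complex-valued functions; equality for complex-valued
  functions and equality for real-valued functions are equivalent.\<close>

definition extension_domain :: "(real \<Rightarrow> real) \<Rightarrow> 'a::euclidean_space set \<Rightarrow> bool" where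
  "extension_domain \<psi> D \<longleftrightarrow>
     proper_subdomain D \<and> (Lip \<psi> D :: ('a \<Rightarrow> complex) set) = locLip \<psi> D"

definition Lip2 ::
  "(real \<Rightarrow> real) \<Rightarrow> 'a::euclidean_space set \<Rightarrow> 'a set \<Rightarrow> ('a \<Rightarrow> 'b::real_normed_vector) set" where
  "Lip2 \<psi> E\<^sub>1 E\<^sub>2 =
     {F. continuous_on (E\<^sub>1 \<union> E\<^sub>2) F \<and>
         (\<exists>C>0. \<forall>x\<in>E\<^sub>1. \<forall>y\<in>E\<^sub>2. norm (F x - F y) \<le> C * \<psi> (dist x y))}"

definition partial_derivative :: "'n::finite \<Rightarrow> (real ^ 'n \<Rightarrow> real) \<Rightarrow> real ^ 'n \<Rightarrow> real" where
  "partial_derivative i f x = deriv (\<lambda>t. f (x + t *\<^sub>R axis i 1)) 0"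

definition gradient :: "(real ^ 'n::finite \<Rightarrow> real) \<Rightarrow> real ^ 'n \<Rightarrow> real ^ 'n" where
  "gradient f x = (\<chi> i. partial_derivative i f x)"

definition laplacian :: "(real ^ 'n::finite \<Rightarrow> real) \<Rightarrow> real ^ 'n \<Rightarrow> real" where
  "laplacian f x = (\<Sum>i\<in>UNIV. partial_derivative i (partial_derivative i f) x)"

text \<open>Differentiability of the function and of its first partial derivatives is required
  explicitly, since \<^const>\<open>deriv\<close> has an unspecified value where no derivative exists.\<close>

definition C2_on :: "(real ^ 'n::finite) set \<Rightarrow> (real ^ 'n \<Rightarrow> real) \<Rightarrow> bool" where
  "C2_on D f \<longleftrightarrow>
     (\<forall>x\<in>D. f differentiable (at x)) \<and>
     (\<forall>i. \<forall>x\<in>D. partial_derivative i f differentiable (at x)) \<and>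
     (\<forall>i j. continuous_on D (partial_derivative j (partial_derivative i f)))"

definition harmonic_on :: "(real ^ 'n::finite) set \<Rightarrow> (real ^ 'n \<Rightarrow> real) \<Rightarrow> bool" where
  "harmonic_on D u \<longleftrightarrow> C2_on D u \<and> (\<forall>x\<in>D. laplacian u x = 0)"

definition grad_mean ::
  "(real ^ 'n::finite) set \<Rightarrow> (real ^ 'n \<Rightarrow> real) \<Rightarrow> real \<Rightarrow> real ^ 'n \<Rightarrow> real" where
  "grad_mean D u p x =
     (1 / measure lebesgue (ball x (bdist D x / 2)) *
      (LINT y:ball x (bdist D x / 2)|lebesgue. norm (gradient u y) powr p)) powr (1 / p)"

end

theory Submission
  imports Defs
begin

text \<open>Write \<open>d\<close> for the distance to the boundary of \<open>\<Omega>\<close>. All conditions are compared with the growth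
  bound F2, \<open>|\<nabla>u| \<le> C \<psi>(d) / d\<close>, along the cycle F1, F3, F4, F2, F1 and the equivalence of F2 and F5.

  The step from F1 to F3 is the triangle inequality, and F4 follows from F3 by extending \<open>|u|\<close> continuously
  to the closure (\<open>Lip_extends_to_frontier\<close>). Under F4, comparison with the nearest boundary point shows that
  \<open>|u|\<close> oscillates by at most a multiple of \<open>\<psi>(d(x))\<close> on the ball around \<open>x\<close> of radius \<open>d(x) / 2\<close>
  (\<open>Lip2_frontier_oscillation\<close>). By the intermediate value theorem \<open>u\<close> then differs from some constant \<open>a\<close>
  by at most a multiple of \<open>\<psi>(d(x))\<close> there (\<open>deviation_le_of_abs_oscillation\<close>), and the interior gradient
  estimate for harmonic functions (\<open>gradient_estimate\<close>) gives F2. From F2, integration of the gradient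
  along short segments gives the local Lipschitz condition (\<open>gradient_bound_imp_locLip\<close>), which
  on an extension domain is the global one, F1.

  F2 gives F5 because \<open>d\<close> varies by a bounded factor on the ball of radius \<open>d(x) / 2\<close>. For the
  converse, \<open>|\<nabla>u(x)|\<^sup>p\<close> must be bounded by a multiple of the mean of \<open>|\<nabla>u|\<^sup>p\<close> over that ball
  (\<open>gradient_powr_sub_mean_value\<close>). For \<open>p = 1\<close> this is the mean value property of the gradient; the
  Hardy-Littlewood argument in \<open>sub_mean_value_powr\<close> transfers it to every \<open>p > 0\<close>.

  The facts on harmonic functions come from one weight, \<open>bump k z = (1 - |z|\<^sup>2)\<^sub>+\<^sup>k\<close>. Since the weight is differentiable and compactly supported on the
  whole space, integration by parts against it is nothing but translation invariance of
  the integral (\<open>bump_integration_by_parts\<close>). It yields the mean value property, the mean value property of the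
  gradient, and the gradient estimate.\<close>

section \<open>A radial weight supported in the unit ball\<close>

text \<open>The unit cube only serves as a fixed closed box that contains the unit ball: every integrand
  below vanishes outside the unit ball, and closed boxes are the domains on which continuous functions are
  integrable and integrals may be differentiated with respect to a parameter.\<close>
abbreviation unit_cube :: "'a::euclidean_space set" where
  "unit_cube \<equiv> cbox (- One) One"

text \<open>The weights \<open>(1 - |z|\<^sup>2)\<^sub>+\<^sup>k\<close>. They are linked by
  \<open>\<nabla> bump (k + 1) = - 2 (k + 1) bump k \<cdot> z\<close>, so that \<open>bump 2\<close> serves as the averaging kernel, while
  \<open>bump 3\<close> and \<open>bump 1\<close> arise from it by integrating and differentiating once.\<close>
definition bump :: "nat \<Rightarrow> 'a::euclidean_space \<Rightarrow> real" where
  "bump k z = (max 0 (1 - z \<bullet> z)) ^ k"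

lemma bump_nonneg: "0 \<le> bump k z"
  by (simp add: bump_def)

lemma bump_le_1: "bump k z \<le> 1"
  unfolding bump_def by (rule power_le_one) auto

lemma bump_eq_0:
  assumes "1 \<le> norm z" "1 \<le> k"
  shows "bump k z = 0"
proof -
  have "1 \<le> (norm z)\<^sup>2"
    using assms by simp
  then show ?thesis
    using assms by (simp add: bump_def dot_square_norm)
qed

lemma has_real_derivative_eventually_0:
  fixes f :: "real \<Rightarrow> real"
  assumes "\<forall>\<^sub>F t in nhds s. f t = 0"
  shows "(f has_real_derivative 0) (at s)"
proof -
  have "((\<lambda>t. 0) has_real_derivative 0) (at s)"
    by simp
  with assms show ?thesis
    using DERIV_cong_ev[of s s f "\<lambda>t. 0" 0 0] by simp
qed

lemma has_real_derivative_pos_part_power: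
  assumes "1 \<le> k"
  shows "((\<lambda>s::real. max 0 s ^ Suc k) has_real_derivative (real (Suc k) * max 0 s ^ k)) (at s)"
proof -
  consider "s > 0" | "s < 0" | "s = 0" by linarith
  then show ?thesis
  proof cases
    case 1
    have "((\<lambda>s::real. s ^ Suc k) has_real_derivative (real (Suc k) * s ^ k)) (at s)"
      using DERIV_pow[of "Suc k" s] by simp
    moreover have "eventually (\<lambda>t. max 0 t ^ Suc k = t ^ Suc k) (nhds s)"
      using eventually_nhds_in_open[of "{0<..}" s] 1 by (auto elim!: eventually_mono)
    ultimately show ?thesis
      using 1 by (subst DERIV_cong_ev[OF refl _ refl]) auto
  next
    case 2
    have "eventually (\<lambda>t. max 0 t ^ Suc k = 0) (nhds s)"
      using eventually_nhds_in_open[of "{..<0}" s] 2 by (auto elim!: eventually_mono)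
    then have "((\<lambda>t. max 0 t ^ Suc k) has_real_derivative 0) (at s)"
      by (rule has_real_derivative_eventually_0)
    moreover have "real (Suc k) * max 0 s ^ k = 0"
      using 2 assms by auto
    ultimately show ?thesis
      by (simp only:)
  next
    case 3
    have "((\<lambda>h. max 0 h ^ Suc k / h) \<longlongrightarrow> 0) (at (0::real))"
    proof (rule Lim_null_comparison)
      show "\<forall>\<^sub>F h in at (0::real). norm (max 0 h ^ Suc k / h) \<le> max 0 h ^ k"
        by (rule always_eventually) (auto simp: max_def)
      have "((\<lambda>h::real. max 0 h ^ k) \<longlongrightarrow> max 0 0 ^ k) (at 0)"
        by (intro tendsto_intros)
      moreover have "max 0 (0::real) ^ k = 0"
        using assms by auto
      ultimately show "((\<lambda>h::real. max 0 h ^ k) \<longlongrightarrow> 0) (at 0)"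
        by (simp only:)
    qed
    then show ?thesis
      using 3 assms by (simp add: DERIV_def power_0_left del: power_Suc)
  qed
qed

lemma has_derivative_bump:
  assumes "1 \<le> k"
  shows "(bump (Suc k) has_derivative (\<lambda>h. - (2 * real (Suc k) * bump k z * (z \<bullet> h)))) (at z)"
proof -
  have inner: "((\<lambda>z. 1 - z \<bullet> z) has_derivative (\<lambda>h. - (2 * (z \<bullet> h)))) (at z)"
    by (auto intro!: derivative_eq_intros simp: inner_commute)
  have "((\<lambda>s::real. max 0 s ^ Suc k) has_derivative
      (\<lambda>h. real (Suc k) * max 0 (1 - z \<bullet> z) ^ k * h)) (at (1 - z \<bullet> z))"
    using has_real_derivative_pos_part_power[OF assms] by (simp add: has_field_derivative_def)
  from has_derivative_compose[OF inner this] show ?thesis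
    by (simp add: bump_def[abs_def] algebra_simps)
qed

lemma continuous_on_bump [continuous_intros]:
  assumes "continuous_on S m"
  shows "continuous_on S (\<lambda>p. bump k (m p))"
  unfolding bump_def by (intro continuous_intros assms)

text \<open>A function that is only defined where \<open>m p\<close> lies in the closed unit ball may be multiplied by the
  weight and extended by zero: the two closed pieces, inside and outside, fit together on the unit
  sphere because the weight vanishes there.\<close>
lemma continuous_on_bump_mult:
  fixes f :: "'b::topological_space \<Rightarrow> real"
  assumes k: "1 \<le> k" and m: "continuous_on S m"
    and f: "continuous_on {p \<in> S. norm (m p) \<le> 1} f"
  shows "continuous_on S (\<lambda>p. bump k (m p) * f p)"
proof -
  let ?C = "{p \<in> S. norm (m p) \<le> 1}" and ?C' = "{p \<in> S. 1 \<le> norm (m p)}"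
  have nm: "continuous_on S (\<lambda>p. norm (m p))"
    using m by (intro continuous_intros)
  have "continuous_on (?C \<union> ?C') (\<lambda>p. bump k (m p) * f p)"
  proof (rule continuous_on_Un_local)
    have "closedin (top_of_set S) (S \<inter> (\<lambda>p. norm (m p)) -` {..1})"
      by (intro continuous_closedin_preimage nm) auto
    moreover have "S \<inter> (\<lambda>p. norm (m p)) -` {..1} = ?C" by auto
    moreover have un: "?C \<union> ?C' = S" by auto
    ultimately show "closedin (top_of_set (?C \<union> ?C')) ?C" by simp
    have "closedin (top_of_set S) (S \<inter> (\<lambda>p. norm (m p)) -` {1..})"
      by (intro continuous_closedin_preimage nm) auto
    moreover have "S \<inter> (\<lambda>p. norm (m p)) -` {1..} = ?C'" by auto
    ultimately show "closedin (top_of_set (?C \<union> ?C')) ?C'" using un by simp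
    have "continuous_on ?C m" using m by (rule continuous_on_subset) auto
    then show "continuous_on ?C (\<lambda>p. bump k (m p) * f p)"
      by (intro continuous_intros f)
    show "continuous_on ?C' (\<lambda>p. bump k (m p) * f p)"
      by (rule continuous_on_eq[OF continuous_on_const[of _ 0]]) (use k in \<open>auto simp: bump_eq_0\<close>)
  qed
  moreover have "?C \<union> ?C' = S" by auto
  ultimately show ?thesis by simp
qed

lemma not_in_unit_cube: "z \<notin> unit_cube \<Longrightarrow> 1 < norm z"
proof (rule ccontr)
  assume "z \<notin> unit_cube" "\<not> 1 < norm z"
  then have "\<bar>z \<bullet> b\<bar> \<le> 1" if "b \<in> Basis" for b
    using Basis_le_norm[OF that, of z] by linarith
  then have "z \<in> unit_cube"
    by (force simp: mem_box abs_le_iff)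
  with \<open>z \<notin> unit_cube\<close> show False
    by simp
qed

section \<open>Integration by parts\<close>

text \<open>The integral of \<open>g (z + t e)\<close> over a large box does not depend on \<open>t\<close>, by translation invariance.
  Differentiating at \<open>t = 0\<close> under the integral sign gives the claim.\<close>
lemma integral_directional_derivative_eq_0:
  fixes g g' :: "'a::euclidean_space \<Rightarrow> real"
  assumes deriv: "\<And>z. ((\<lambda>t. g (z + t *\<^sub>R e)) has_real_derivative g' z) (at 0)"
    and g: "continuous_on UNIV g" and g': "continuous_on UNIV g'"
    and g0: "\<And>z. 1 \<le> norm z \<Longrightarrow> g z = 0" and g'0: "\<And>z. 1 < norm z \<Longrightarrow> g' z = 0"
    and e: "norm e \<le> 1"
  shows "integral unit_cube g' = 0"
proof -
  \<comment> \<open>The support of \<open>g\<close> shifted by at most one unit stays inside the doubled cube.\<close>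
  let ?P = "cbox (- 2 *\<^sub>R One) (2 *\<^sub>R One) :: 'a set"
  let ?\<Phi> = "\<lambda>t. integral ?P (\<lambda>z. g (z + t *\<^sub>R e))"
  have const: "?\<Phi> t = integral unit_cube g" if "t \<in> {-1..1}" for t
  proof -
    have "(g has_integral integral unit_cube g) unit_cube"
      by (intro integrable_integral integrable_continuous continuous_on_subset[OF g]) auto
    then have *: "((\<lambda>z. g (z + t *\<^sub>R e)) has_integral integral unit_cube g)
        (cbox (- One - t *\<^sub>R e) (One - t *\<^sub>R e))"
      by (rule has_integral_shift_cbox)
    have "\<bar>t\<bar> * norm e \<le> 1"
      using that e by (intro mult_le_one) auto
    then have b: "\<bar>t * (e \<bullet> b)\<bar> \<le> 1" if "b \<in> Basis" for b
      using Basis_le_norm[OF that, of "t *\<^sub>R e"] by simp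
    have sub: "cbox (- One - t *\<^sub>R e) (One - t *\<^sub>R e) \<subseteq> ?P"
      by (intro subset_box_imp ballI) (use b in \<open>force simp: inner_diff_left abs_le_iff\<close>)
    have "((\<lambda>z. g (z + t *\<^sub>R e)) has_integral integral unit_cube g) ?P"
    proof (rule has_integral_on_superset[OF * _ sub])
      fix z assume z: "z \<notin> cbox (- One - t *\<^sub>R e) (One - t *\<^sub>R e)"
      have "z + t *\<^sub>R e \<notin> unit_cube"
        using z by (auto simp: mem_box inner_simps algebra_simps)
      then show "g (z + t *\<^sub>R e) = 0"
        using not_in_unit_cube by (intro g0) fastforce
    qed
    then show ?thesis by (rule integral_unique)
  qed
  have "(?\<Phi> has_real_derivative integral ?P (\<lambda>z. g' (z + 0 *\<^sub>R e))) (at 0 within {-1..1})"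
  proof (rule leibniz_rule_field_derivative)
    fix s :: real and z :: 'a
    have "((\<lambda>t. g (z + s *\<^sub>R e + t *\<^sub>R e)) has_real_derivative g' (z + s *\<^sub>R e)) (at 0)"
      by (rule deriv)
    then have "((\<lambda>t. g (z + (t + s) *\<^sub>R e)) has_real_derivative g' (z + s *\<^sub>R e)) (at 0)"
      by (simp add: algebra_simps)
    then have "((\<lambda>t. g (z + t *\<^sub>R e)) has_real_derivative g' (z + s *\<^sub>R e)) (at (0 + s))"
      by (subst DERIV_shift)
    then show "((\<lambda>t. g (z + t *\<^sub>R e)) has_real_derivative g' (z + s *\<^sub>R e)) (at s within {-1..1})"
      by (auto intro: has_field_derivative_at_within)
  next
    fix t
    show "(\<lambda>z. g (z + t *\<^sub>R e)) integrable_on ?P"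
      by (intro integrable_continuous continuous_on_compose2[OF g] continuous_intros) auto
  next
    show "continuous_on ({-1..1} \<times> ?P) (\<lambda>(t, z). g' (z + t *\<^sub>R e))"
      unfolding case_prod_unfold
      by (intro continuous_on_compose2[OF g'] continuous_intros) auto
  qed auto
  moreover have "(?\<Phi> has_real_derivative 0) (at 0 within {-1..1})"
    by (rule has_field_derivative_transform_within[OF DERIV_const[of "integral unit_cube g"] zero_less_one])
      (use const in auto)
  ultimately have "((\<lambda>z. ?\<Phi> z) has_real_derivative integral ?P g') (at 0)" "(?\<Phi> has_real_derivative 0) (at 0)"
    by (simp_all add: at_within_Icc_at)
  then have "integral ?P g' = 0"
    by (rule DERIV_unique)
  moreover have "integral ?P g' = integral unit_cube g'"
  proof (rule integral_unique[OF has_integral_on_superset])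
    show "(g' has_integral integral unit_cube g') unit_cube"
      by (intro integrable_integral integrable_continuous continuous_on_subset[OF g']) auto
    show "(unit_cube :: 'a set) \<subseteq> ?P"
      by (rule subset_box_imp) auto
    show "g' z = 0" if "z \<notin> unit_cube" for z
      using not_in_unit_cube[OF that] by (rule g'0)
  qed
  ultimately show ?thesis by simp
qed

text \<open>The previous lemma, applied to \<open>g z = bump (k + 1) z \<cdot> f (x + r z)\<close>: the product rule produces
  both sides.\<close>
lemma bump_integration_by_parts:
  fixes f :: "'a::euclidean_space \<Rightarrow> real"
  assumes \<Omega>: "open \<Omega>" "cball x r \<subseteq> \<Omega>" "0 \<le> r" and e: "norm e \<le> 1" and k: "1 \<le> k"
    and f: "\<And>y. y \<in> \<Omega> \<Longrightarrow> (f has_derivative f' y) (at y)"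
    and f': "continuous_on \<Omega> (\<lambda>y. f' y e)"
  shows "r * integral unit_cube (\<lambda>z. bump (Suc k) z * f' (x + r *\<^sub>R z) e) =
    2 * real (Suc k) * integral unit_cube (\<lambda>z. bump k z * ((z \<bullet> e) * f (x + r *\<^sub>R z)))"
proof -
  have inside: "x + r *\<^sub>R z \<in> \<Omega>" if "norm z \<le> 1" for z
    using \<Omega> that by (auto simp: dist_norm subset_iff mult_left_le)
  have cf: "continuous_on \<Omega> f"
    using f by (meson has_derivative_continuous continuous_at_imp_continuous_on)
  have cont1: "continuous_on UNIV (\<lambda>z. bump (Suc k) z * f (x + r *\<^sub>R z))"
    by (rule continuous_on_bump_mult)
       (auto intro!: continuous_intros continuous_on_compose2[OF cf] inside)
  have cont2: "continuous_on UNIV (\<lambda>z. bump (Suc k) z * f' (x + r *\<^sub>R z) e)"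
    by (rule continuous_on_bump_mult)
       (auto intro!: continuous_intros continuous_on_compose2[OF f'] inside)
  have cont3: "continuous_on UNIV (\<lambda>z. bump k z * ((z \<bullet> e) * f (x + r *\<^sub>R z)))"
    by (rule continuous_on_bump_mult[OF k])
       (auto intro!: continuous_intros continuous_on_compose2[OF cf] inside)
  let ?g' = "\<lambda>z. r * (bump (Suc k) z * f' (x + r *\<^sub>R z) e) -
      2 * real (Suc k) * (bump k z * ((z \<bullet> e) * f (x + r *\<^sub>R z)))"
  have "integral unit_cube ?g' = 0"
  proof (rule integral_directional_derivative_eq_0[OF _ cont1 _ _ _ e])
    show "continuous_on UNIV ?g'"
      by (intro continuous_intros cont2 cont3)
    show "bump (Suc k) z * f (x + r *\<^sub>R z) = 0" if "1 \<le> norm z" for z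
      using that by (simp add: bump_eq_0)
    show "?g' z = 0" if "1 < norm z" for z
      using that k by (simp add: bump_eq_0)
    fix z :: 'a
    have line: "((\<lambda>t. z + t *\<^sub>R e) has_derivative (\<lambda>t. t *\<^sub>R e)) (at 0)"
      by (auto intro!: derivative_eq_intros)
    show "((\<lambda>t. bump (Suc k) (z + t *\<^sub>R e) * f (x + r *\<^sub>R (z + t *\<^sub>R e))) has_real_derivative ?g' z) (at 0)"
    proof (cases "norm z \<le> 1")
      case True
      have b: "(bump (Suc k) has_derivative (\<lambda>h. - (2 * real (Suc k) * bump k z * (z \<bullet> h)))) (at (z + 0 *\<^sub>R e))"
        using has_derivative_bump[OF k, of z] by simp
      have "(f has_derivative f' (x + r *\<^sub>R z)) (at (x + r *\<^sub>R (z + 0 *\<^sub>R e)))"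
        using f[OF inside[OF True]] by simp
      moreover have line2: "((\<lambda>t. x + r *\<^sub>R (z + t *\<^sub>R e)) has_derivative (\<lambda>t. (t * r) *\<^sub>R e)) (at 0)"
        by (auto intro!: derivative_eq_intros simp: mult.commute)
      ultimately have 1: "((\<lambda>t. f (x + r *\<^sub>R (z + t *\<^sub>R e))) has_derivative (\<lambda>t. f' (x + r *\<^sub>R z) ((t * r) *\<^sub>R e))) (at 0)"
        using has_derivative_compose[OF line2] by blast
      have lin: "linear (f' (x + r *\<^sub>R z))"
        using f[OF inside[OF True]] has_derivative_linear by blast
      have 2: "((\<lambda>t. bump (Suc k) (z + t *\<^sub>R e)) has_derivative (\<lambda>t. - (2 * real (Suc k) * bump k z * (z \<bullet> (t *\<^sub>R e))))) (at 0)"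
        using has_derivative_compose[OF line b] .
      show ?thesis
        unfolding has_field_derivative_def
        by (rule has_derivative_eq_rhs[OF has_derivative_mult[OF 2 1]])
           (auto simp: linear_cmul[OF lin] fun_eq_iff algebra_simps)
    next
      case False
      have "continuous (at 0) (\<lambda>t. norm (z + t *\<^sub>R e))"
        by (intro continuous_intros)
      then have "((\<lambda>t. norm (z + t *\<^sub>R e)) \<longlongrightarrow> norm z) (nhds 0)"
        by (simp add: continuous_at tendsto_nhds_iff)
      then have "\<forall>\<^sub>F t in nhds 0. 1 < norm (z + t *\<^sub>R e)"
        using False by (intro order_tendstoD(1)[where a = 1]) auto
      then have "\<forall>\<^sub>F t in nhds 0. bump (Suc k) (z + t *\<^sub>R e) * f (x + r *\<^sub>R (z + t *\<^sub>R e)) = 0"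
        by eventually_elim (simp add: bump_eq_0)
      then have "((\<lambda>t. bump (Suc k) (z + t *\<^sub>R e) * f (x + r *\<^sub>R (z + t *\<^sub>R e))) has_real_derivative 0) (at 0)"
        by (rule has_real_derivative_eventually_0)
      then show ?thesis
        using False k by (simp add: bump_eq_0)
    qed
  qed
  moreover have "integral unit_cube ?g' = r * integral unit_cube (\<lambda>z. bump (Suc k) z * f' (x + r *\<^sub>R z) e) -
    2 * real (Suc k) * integral unit_cube (\<lambda>z. bump k z * ((z \<bullet> e) * f (x + r *\<^sub>R z)))"
    by (subst integral_diff)
       (auto intro!: integrable_continuous continuous_intros continuous_on_subset[OF cont2] continuous_on_subset[OF cont3])
  ultimately show ?thesis by simp
qed

section \<open>Weighted integrals over balls\<close>
lemma continuous_on_ball_integrable: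
  fixes f :: "'a::euclidean_space \<Rightarrow> real"
  assumes "continuous_on (cball x r) f"
  shows "f absolutely_integrable_on ball x r"
proof -
  have int: "integrable lborel (\<lambda>y. indicator (cball x r) y *\<^sub>R f y)"
    using assms by (intro borel_integrable_compact) auto
  then have "f absolutely_integrable_on cball x r"
    unfolding set_integrable_def using integrable_completion borel_measurable_integrable by blast
  then show ?thesis
    by (rule set_integrable_subset) auto
qed

lemma scaled_unit_ball_subset:
  "cball x r \<subseteq> \<Omega> \<Longrightarrow> 0 \<le> r \<Longrightarrow> norm z \<le> 1 \<Longrightarrow> x + r *\<^sub>R z \<in> \<Omega>"
  by (auto simp: dist_norm subset_iff mult_left_le)

lemma continuous_on_bump_scaled:
  fixes f :: "'a::euclidean_space \<Rightarrow> real"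
  assumes "continuous_on \<Omega> f" "cball x r \<subseteq> \<Omega>" "0 \<le> r" "1 \<le> k"
  shows "continuous_on S (\<lambda>z. bump k z * f (x + r *\<^sub>R z))"
  using assms(4)
  by (rule continuous_on_bump_mult)
     (auto intro!: continuous_intros continuous_on_compose2[OF assms(1)] scaled_unit_ball_subset[OF assms(2,3)])

lemma integral_bump_pos: "0 < integral unit_cube (bump k :: 'a::euclidean_space \<Rightarrow> real)"
proof -
  have c: "continuous_on unit_cube (bump k :: 'a \<Rightarrow> real)"
    by (intro continuous_intros)
  have "0 \<le> integral unit_cube (bump k :: 'a \<Rightarrow> real)"
    by (intro integral_nonneg integrable_continuous c) (auto simp: bump_nonneg)
  moreover have "integral unit_cube (bump k :: 'a \<Rightarrow> real) \<noteq> 0"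
  proof
    assume "integral unit_cube (bump k :: 'a \<Rightarrow> real) = 0"
    then have "((bump k :: 'a \<Rightarrow> real) has_integral 0) unit_cube"
      using integrable_integral[OF integrable_continuous[OF c]] by simp
    from has_integral_0_cbox_imp_0[OF c _ this, of 0] have "bump k (0 :: 'a) = 0"
      by (auto simp: bump_nonneg mem_box box_ne_empty)
    then show False
      by (simp add: bump_def)
  qed
  ultimately show ?thesis by simp
qed

text \<open>Averages over the unit ball with weight \<open>bump k \<le> 1\<close> are turned into plain integrals over the ball
  of radius \<open>r\<close> by the substitution \<open>y = x + r z\<close>.\<close>
lemma bump_average_le_integral_ball:
  fixes f :: "'a::euclidean_space \<Rightarrow> real"
  assumes f: "continuous_on (cball x r) f" and f0: "\<And>y. y \<in> cball x r \<Longrightarrow> 0 \<le> f y"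
    and r: "0 < r" and k: "1 \<le> k"
  shows "r ^ DIM('a) * integral unit_cube (\<lambda>z. bump k z * f (x + r *\<^sub>R z)) \<le> integral (ball x r) f"
proof -
  let ?h = "\<lambda>y. bump k ((y - x) /\<^sub>R r) * f y"
  let ?Q = "cbox (x - r *\<^sub>R One) (x + r *\<^sub>R One)"
  have out: "?h y = 0" if "y \<notin> ball x r" for y
  proof -
    have "norm ((y - x) /\<^sub>R r) = norm (y - x) / r"
      using r by (simp add: divide_inverse mult.commute)
    also have "1 \<le> norm (y - x) / r"
      using that r by (simp add: dist_norm norm_minus_commute)
    finally show ?thesis
      using k by (simp add: bump_eq_0)
  qed
  have "continuous_on (cball x r) ?h"
    by (intro continuous_intros f)
  then have hb: "(?h has_integral integral (ball x r) ?h) (ball x r)"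
    by (intro integrable_integral set_lebesgue_integral_eq_integral(1) continuous_on_ball_integrable)
  have sub: "ball x r \<subseteq> ?Q"
  proof
    fix y assume y: "y \<in> ball x r"
    have "\<bar>(y - x) \<bullet> b\<bar> \<le> r" if "b \<in> Basis" for b
      using Basis_le_norm[OF that, of "y - x"] y by (simp add: dist_norm norm_minus_commute)
    then show "y \<in> ?Q"
      by (force simp: mem_box inner_simps abs_le_iff)
  qed
  have "(?h has_integral integral (ball x r) ?h) ?Q"
    using hb out sub by (rule has_integral_on_superset)
  then have "((\<lambda>z. ?h (r *\<^sub>R z + x)) has_integral (integral (ball x r) ?h /\<^sub>R r ^ DIM('a)))
      (cbox (((x - r *\<^sub>R One) - x) /\<^sub>R r) (((x + r *\<^sub>R One) - x) /\<^sub>R r))"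
    by (rule has_integral_affinity'[OF _ r])
  then have "((\<lambda>z. bump k z * f (x + r *\<^sub>R z)) has_integral (integral (ball x r) ?h /\<^sub>R r ^ DIM('a))) unit_cube"
    using r by (simp add: add.commute)
  then have "integral unit_cube (\<lambda>z. bump k z * f (x + r *\<^sub>R z)) = integral (ball x r) ?h /\<^sub>R r ^ DIM('a)"
    by (rule integral_unique)
  then have "r ^ DIM('a) * integral unit_cube (\<lambda>z. bump k z * f (x + r *\<^sub>R z)) = integral (ball x r) ?h"
    using r by simp
  also have "\<dots> \<le> integral (ball x r) f"
  proof (rule integral_le)
    show "?h integrable_on ball x r"
      using hb by blast
    show "f integrable_on ball x r"
      by (intro set_lebesgue_integral_eq_integral(1) continuous_on_ball_integrable f)
    show "?h y \<le> f y" if "y \<in> ball x r" for y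
      using f0[of y] that bump_le_1[of k "(y - x) /\<^sub>R r"] by (intro mult_left_le_one_le) (auto simp: bump_nonneg)
  qed
  finally show ?thesis .
qed

section \<open>Mean values of harmonic functions\<close>
lemma has_derivative_gradient:
  fixes f :: "real ^ 'n::finite \<Rightarrow> real"
  assumes "f differentiable (at x)"
  shows "(f has_derivative (\<lambda>h. gradient f x \<bullet> h)) (at x)"
proof -
  obtain f' where f': "(f has_derivative f') (at x)"
    using assms unfolding differentiable_def by blast
  then have lin: "linear f'"
    by (rule has_derivative_linear)
  have partial: "partial_derivative i f x = f' (axis i 1)" for i
  proof -
    have line: "((\<lambda>t. x + t *\<^sub>R axis i 1) has_derivative (\<lambda>t. t *\<^sub>R axis i 1)) (at 0)"
      by (auto intro!: derivative_eq_intros)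
    have "(f has_derivative f') (at (x + 0 *\<^sub>R axis i 1))"
      using f' by simp
    from has_derivative_compose[OF line this]
    have "((\<lambda>t. f (x + t *\<^sub>R axis i 1)) has_real_derivative f' (axis i 1)) (at 0)"
      by (simp add: has_field_derivative_def linear_cmul[OF lin] mult.commute[of _ "f' (axis i 1)"])
    then show ?thesis
      unfolding partial_derivative_def by (rule DERIV_imp_deriv)
  qed
  have "f' h = gradient f x \<bullet> h" for h
  proof -
    have "f' h = f' (\<Sum>i\<in>UNIV. h $ i *\<^sub>R axis i 1)"
      using basis_expansion[of h] by (simp add: scalar_mult_eq_scaleR)
    also have "\<dots> = (\<Sum>i\<in>UNIV. h $ i * f' (axis i 1))"
      by (simp add: linear_sum[OF lin] linear_cmul[OF lin])
    also have "\<dots> = gradient f x \<bullet> h"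
      by (simp add: inner_vec_def gradient_def partial mult.commute)
    finally show ?thesis .
  qed
  then have "f' = (\<lambda>h. gradient f x \<bullet> h)" ..
  with f' show ?thesis by simp
qed

lemma gradient_component: "gradient f x $ i = partial_derivative i f x"
  by (simp add: gradient_def)

lemma harmonic_on_has_derivative:
  "harmonic_on \<Omega> u \<Longrightarrow> x \<in> \<Omega> \<Longrightarrow> (u has_derivative (\<lambda>h. gradient u x \<bullet> h)) (at x)"
  by (rule has_derivative_gradient) (simp add: harmonic_on_def C2_on_def)

lemma harmonic_on_continuous:
  assumes "harmonic_on \<Omega> u"
  shows "continuous_on \<Omega> u"
  using harmonic_on_has_derivative[OF assms]
  by (meson has_derivative_continuous continuous_at_imp_continuous_on)

lemma harmonic_on_continuous_gradient:
  assumes "harmonic_on \<Omega> u"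
  shows "continuous_on \<Omega> (gradient u)"
proof -
  have "continuous_on \<Omega> (partial_derivative i u)" for i
    using assms by (auto simp: harmonic_on_def C2_on_def
        intro!: continuous_at_imp_continuous_on differentiable_imp_continuous_within)
  then show ?thesis
    unfolding gradient_def[abs_def] by (intro continuous_on_vec_lambda)
qed

text \<open>The field \<open>z \<cdot> bump 2 z\<close> is a multiple of the gradient of \<open>bump 3\<close>. Moving this derivative to
  \<open>\<nabla>u\<close>, one coordinate at a time, leaves the Laplacian of \<open>u\<close> integrated against \<open>bump 3\<close>.\<close>
lemma harmonic_radial_derivative_integral_eq_0:
  fixes u :: "real ^ 'n::finite \<Rightarrow> real"
  assumes \<Omega>: "open \<Omega>" "cball x r \<subseteq> \<Omega>" "0 \<le> r" and u: "harmonic_on \<Omega> u"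
  shows "integral unit_cube (\<lambda>z. bump 2 z * (gradient u (x + r *\<^sub>R z) \<bullet> z)) = 0"
proof -
  have diff: "partial_derivative i u differentiable (at y)" if "y \<in> \<Omega>" for i y
    using u that by (auto simp: harmonic_on_def C2_on_def)
  have cont: "continuous_on \<Omega> (partial_derivative j (partial_derivative i u))" for i j
    using u by (auto simp: harmonic_on_def C2_on_def)
  have cont1: "continuous_on \<Omega> (partial_derivative i u)" for i
    using diff by (auto intro!: continuous_at_imp_continuous_on differentiable_imp_continuous_within)
  have parts: "r * integral unit_cube (\<lambda>z. bump 3 z * partial_derivative i (partial_derivative i u) (x + r *\<^sub>R z)) =
      6 * integral unit_cube (\<lambda>z. bump 2 z * (z $ i * partial_derivative i u (x + r *\<^sub>R z)))" for i
    using bump_integration_by_parts[OF \<Omega>, of "axis i 1" 2 "partial_derivative i u"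
        "\<lambda>y h. gradient (partial_derivative i u) y \<bullet> h"]
    by (simp add: has_derivative_gradient diff cont gradient_component inner_axis numeral_eq_Suc)
  have int3: "(\<lambda>z. bump 3 z * partial_derivative i (partial_derivative i u) (x + r *\<^sub>R z)) integrable_on unit_cube" for i
    by (intro integrable_continuous continuous_on_bump_scaled[OF cont \<Omega>(2,3)]) simp
  have int2: "(\<lambda>z. bump 2 z * (z $ i * partial_derivative i u (x + r *\<^sub>R z))) integrable_on unit_cube" for i
    by (intro integrable_continuous continuous_on_bump_mult)
       (auto intro!: continuous_intros continuous_on_compose2[OF cont1] scaled_unit_ball_subset[OF \<Omega>(2,3)])
  have "6 * integral unit_cube (\<lambda>z. bump 2 z * (gradient u (x + r *\<^sub>R z) \<bullet> z)) =
      6 * integral unit_cube (\<lambda>z. \<Sum>i\<in>UNIV. bump 2 z * (z $ i * partial_derivative i u (x + r *\<^sub>R z)))"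
    by (simp add: inner_vec_def gradient_def sum_distrib_left mult.commute)
  also have "\<dots> = (\<Sum>i\<in>UNIV. 6 * integral unit_cube (\<lambda>z. bump 2 z * (z $ i * partial_derivative i u (x + r *\<^sub>R z))))"
    by (subst integral_sum) (auto simp: int2 sum_distrib_left)
  also have "\<dots> = r * (\<Sum>i\<in>UNIV. integral unit_cube (\<lambda>z. bump 3 z * partial_derivative i (partial_derivative i u) (x + r *\<^sub>R z)))"
    by (simp add: parts[symmetric] sum_distrib_left)
  also have "\<dots> = r * integral unit_cube (\<lambda>z. \<Sum>i\<in>UNIV. bump 3 z * partial_derivative i (partial_derivative i u) (x + r *\<^sub>R z))"
    by (subst integral_sum) (auto simp: int3)
  also have "\<dots> = r * integral unit_cube (\<lambda>z. bump 3 z * laplacian u (x + r *\<^sub>R z))"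
    by (simp add: laplacian_def sum_distrib_left)
  also have "integral unit_cube (\<lambda>z. bump 3 z * laplacian u (x + r *\<^sub>R z)) = integral unit_cube (\<lambda>z :: real ^ 'n. 0)"
  proof (rule Henstock_Kurzweil_Integration.integral_cong)
    fix z :: "real ^ 'n"
    show "bump 3 z * laplacian u (x + r *\<^sub>R z) = 0"
    proof (cases "norm z \<le> 1")
      case True
      then show ?thesis
        using scaled_unit_ball_subset[OF \<Omega>(2,3)] u by (simp add: harmonic_on_def)
    qed (simp add: bump_eq_0)
  qed
  finally show ?thesis by simp
qed

text \<open>The weighted mean over the ball of radius \<open>t\<close> has as derivative in \<open>t\<close> the integral of
  \<open>bump 2 z \<cdot> (\<nabla>u (x + t z) \<bullet> z)\<close>, which is zero, so it has the same value at \<open>t = r\<close> and \<open>t = 0\<close>.\<close>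
lemma harmonic_mean_value:
  fixes u :: "real ^ 'n::finite \<Rightarrow> real"
  assumes \<Omega>: "open \<Omega>" "cball x r \<subseteq> \<Omega>" "0 \<le> r" and u: "harmonic_on \<Omega> u"
  shows "integral unit_cube (\<lambda>z. bump 2 z * u (x + r *\<^sub>R z)) = integral unit_cube (bump 2 :: real ^ 'n \<Rightarrow> real) * u x"
proof -
  have sub: "cball x t \<subseteq> \<Omega>" if "t \<in> {0..r}" for t
    using \<Omega>(2) that by auto
  let ?\<Phi> = "\<lambda>t. integral unit_cube (\<lambda>z. bump 2 z * u (x + t *\<^sub>R z))"
  have "(?\<Phi> has_real_derivative 0) (at t within {0..r})" if t: "t \<in> {0..r}" for t
  proof -
    have "(?\<Phi> has_real_derivative
        integral unit_cube (\<lambda>z. bump 2 z * (gradient u (x + t *\<^sub>R z) \<bullet> z))) (at t within {0..r})"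
    proof (rule leibniz_rule_field_derivative[OF _ _ _ t])
      fix s :: real and z :: "real ^ 'n" assume s: "s \<in> {0..r}"
      show "((\<lambda>t. bump 2 z * u (x + t *\<^sub>R z)) has_real_derivative
          bump 2 z * (gradient u (x + s *\<^sub>R z) \<bullet> z)) (at s within {0..r})"
      proof (cases "norm z \<le> 1")
        case True
        have "x + s *\<^sub>R z \<in> \<Omega>"
          using scaled_unit_ball_subset[OF sub[OF s] _ True] s by simp
        note d = harmonic_on_has_derivative[OF u this]
        have line: "((\<lambda>t. x + t *\<^sub>R z) has_derivative (\<lambda>t. t *\<^sub>R z)) (at s)"
          by (auto intro!: derivative_eq_intros)
        have "((\<lambda>t. u (x + t *\<^sub>R z)) has_real_derivative gradient u (x + s *\<^sub>R z) \<bullet> z) (at s)"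
          using has_derivative_compose[OF line d]
          by (simp add: has_field_derivative_def mult.commute[of _ "gradient u (x + s *\<^sub>R z) \<bullet> z"])
        then show ?thesis
          by (rule has_field_derivative_at_within[OF DERIV_cmult])
      qed (simp add: bump_eq_0)
    next
      fix s assume "s \<in> {0..r}"
      then show "(\<lambda>z. bump 2 z * u (x + s *\<^sub>R z)) integrable_on unit_cube"
        by (intro integrable_continuous continuous_on_bump_scaled[OF harmonic_on_continuous[OF u] sub]) auto
    next
      show "continuous_on ({0..r} \<times> unit_cube) (\<lambda>(t, z). bump 2 z * (gradient u (x + t *\<^sub>R z) \<bullet> z))"
        unfolding case_prod_unfold
        by (rule continuous_on_bump_mult)
           (auto intro!: continuous_intros continuous_on_compose2[OF harmonic_on_continuous_gradient[OF u]]
             scaled_unit_ball_subset[OF sub])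
    qed simp
    then show ?thesis
      using harmonic_radial_derivative_integral_eq_0[OF \<Omega>(1) sub[OF t] _ u] t by simp
  qed
  then obtain c where c: "\<And>t. t \<in> {0..r} \<Longrightarrow> ?\<Phi> t = c"
    using has_field_derivative_zero_constant[of "{0..r}" ?\<Phi>] by auto
  have "?\<Phi> r = ?\<Phi> 0"
    using c[of r] c[of 0] \<Omega>(3) by simp
  then show ?thesis by simp
qed

text \<open>The mean value property, differentiated with respect to the centre in the direction \<open>e\<close>. The slightly larger ball leaves room to move the centre.\<close>
lemma gradient_mean_value:
  fixes u :: "real ^ 'n::finite \<Rightarrow> real"
  assumes \<Omega>: "open \<Omega>" "cball x R \<subseteq> \<Omega>" "0 \<le> r" "r < R" and u: "harmonic_on \<Omega> u" and e: "norm e \<le> 1"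
  shows "integral unit_cube (\<lambda>z. bump 2 z * (gradient u (x + r *\<^sub>R z) \<bullet> e)) =
    integral unit_cube (bump 2 :: real ^ 'n \<Rightarrow> real) * (gradient u x \<bullet> e)"
proof -
  define \<delta> where "\<delta> = R - r"
  have \<delta>: "0 < \<delta>" using \<Omega> by (simp add: \<delta>_def)
  have sub: "cball (x + t *\<^sub>R e) r \<subseteq> \<Omega>" if "t \<in> {-\<delta>..\<delta>}" for t
  proof -
    have "norm (t *\<^sub>R e) \<le> \<delta>"
      using mult_mono[of "\<bar>t\<bar>" \<delta> "norm e" 1] that e \<delta> by auto
    moreover have "dist (x + t *\<^sub>R e) x = norm (t *\<^sub>R e)"
      by (simp add: dist_norm)
    ultimately have "cball (x + t *\<^sub>R e) r \<subseteq> cball x R"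
      by (simp add: cball_subset_cball_iff \<delta>_def)
    then show ?thesis using \<Omega>(2) by simp
  qed
  let ?\<Phi> = "\<lambda>t. integral unit_cube (\<lambda>z. bump 2 z * u (x + t *\<^sub>R e + r *\<^sub>R z))"
  have lin: "((\<lambda>t. u (y + t *\<^sub>R e)) has_real_derivative gradient u (y + s *\<^sub>R e) \<bullet> e) (at s)"
    if "y + s *\<^sub>R e \<in> \<Omega>" for y s
  proof -
    have line: "((\<lambda>t. y + t *\<^sub>R e) has_derivative (\<lambda>t. t *\<^sub>R e)) (at s)"
      by (auto intro!: derivative_eq_intros)
    show ?thesis
      using has_derivative_compose[OF line harmonic_on_has_derivative[OF u that]]
      by (simp add: has_field_derivative_def mult.commute[of _ "gradient u (y + s *\<^sub>R e) \<bullet> e"])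
  qed
  have within: "at 0 within {-\<delta>..\<delta>} = at 0"
    using \<delta> by (simp add: at_within_Icc_at)
  have "(?\<Phi> has_real_derivative
      integral unit_cube (\<lambda>z. bump 2 z * (gradient u (x + 0 *\<^sub>R e + r *\<^sub>R z) \<bullet> e))) (at 0 within {-\<delta>..\<delta>})"
  proof (rule leibniz_rule_field_derivative)
    fix s :: real and z :: "real ^ 'n" assume s: "s \<in> {-\<delta>..\<delta>}"
    show "((\<lambda>t. bump 2 z * u (x + t *\<^sub>R e + r *\<^sub>R z)) has_real_derivative
        bump 2 z * (gradient u (x + s *\<^sub>R e + r *\<^sub>R z) \<bullet> e)) (at s within {-\<delta>..\<delta>})"
    proof (cases "norm z \<le> 1")
      case True
      have swap: "x + t *\<^sub>R e + r *\<^sub>R z = (x + r *\<^sub>R z) + t *\<^sub>R e" for t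
        by simp
      have mem: "(x + r *\<^sub>R z) + s *\<^sub>R e \<in> \<Omega>"
        using scaled_unit_ball_subset[OF sub[OF s] \<Omega>(3) True] by (simp only: swap)
      show ?thesis
        unfolding swap by (rule has_field_derivative_at_within[OF DERIV_cmult[OF lin[OF mem]]])
    qed (simp add: bump_eq_0)
  next
    fix s assume "s \<in> {-\<delta>..\<delta>}"
    then show "(\<lambda>z. bump 2 z * u (x + s *\<^sub>R e + r *\<^sub>R z)) integrable_on unit_cube"
      by (intro integrable_continuous continuous_on_bump_scaled[OF harmonic_on_continuous[OF u] sub \<Omega>(3)]) auto
  next
    show "continuous_on ({-\<delta>..\<delta>} \<times> unit_cube) (\<lambda>(t, z). bump 2 z * (gradient u (x + t *\<^sub>R e + r *\<^sub>R z) \<bullet> e))"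
      unfolding case_prod_unfold
      by (rule continuous_on_bump_mult)
         (auto intro!: continuous_intros continuous_on_compose2[OF harmonic_on_continuous_gradient[OF u]]
           scaled_unit_ball_subset[OF sub \<Omega>(3)])
  qed (use \<delta> in auto)
  moreover have "(?\<Phi> has_real_derivative integral unit_cube (bump 2 :: real ^ 'n \<Rightarrow> real) * (gradient u x \<bullet> e))
      (at 0 within {-\<delta>..\<delta>})"
  proof (rule has_field_derivative_transform_within[OF _ \<delta>])
    have "x + 0 *\<^sub>R e \<in> \<Omega>"
      using sub[of 0] \<delta> \<Omega>(3) by auto
    from lin[OF this] show "((\<lambda>t. integral unit_cube (bump 2 :: real ^ 'n \<Rightarrow> real) * u (x + t *\<^sub>R e)) has_real_derivative
        integral unit_cube (bump 2 :: real ^ 'n \<Rightarrow> real) * (gradient u x \<bullet> e)) (at 0 within {-\<delta>..\<delta>})"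
      using has_field_derivative_at_within[OF DERIV_cmult] by simp
    show "integral unit_cube (bump 2 :: real ^ 'n \<Rightarrow> real) * u (x + t *\<^sub>R e) = ?\<Phi> t" if "t \<in> {-\<delta>..\<delta>}" for t
      using harmonic_mean_value[OF \<Omega>(1) sub[OF that] \<Omega>(3) u] by simp
  qed (use \<delta> in auto)
  ultimately have "integral unit_cube (\<lambda>z. bump 2 z * (gradient u (x + 0 *\<^sub>R e + r *\<^sub>R z) \<bullet> e)) =
      integral unit_cube (bump 2 :: real ^ 'n \<Rightarrow> real) * (gradient u x \<bullet> e)"
    unfolding within by (rule DERIV_unique)
  then show ?thesis
    by simp
qed

lemma inner_sgn_self: "v \<bullet> sgn v = norm v"
  by (cases "v = 0") (simp_all add: sgn_div_norm dot_square_norm power2_eq_square)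

text \<open>The mean value property for the derivative in the direction of \<open>\<nabla>u x\<close>, whose value at \<open>x\<close> is
  \<open>|\<nabla>u x|\<close> and whose values elsewhere are at most \<open>|\<nabla>u|\<close>.\<close>
lemma gradient_sub_mean_value:
  fixes u :: "real ^ 'n::finite \<Rightarrow> real"
  assumes \<Omega>: "open \<Omega>" "cball x R \<subseteq> \<Omega>" "0 < r" "r < R" and u: "harmonic_on \<Omega> u"
  shows "r ^ CARD('n) * (integral unit_cube (bump 2 :: real ^ 'n \<Rightarrow> real) * norm (gradient u x)) \<le>
    integral (ball x r) (\<lambda>y. norm (gradient u y))"
proof -
  have sub: "cball x r \<subseteq> \<Omega>"
    using \<Omega> by auto
  have r0: "0 \<le> r" using \<Omega> by simp
  note cg = harmonic_on_continuous_gradient[OF u]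
  define e where "e = sgn (gradient u x)"
  have e: "norm e \<le> 1" "gradient u x \<bullet> e = norm (gradient u x)"
    by (simp_all add: e_def norm_sgn inner_sgn_self)
  have "integral unit_cube (bump 2 :: real ^ 'n \<Rightarrow> real) * norm (gradient u x) =
      integral unit_cube (\<lambda>z. bump 2 z * (gradient u (x + r *\<^sub>R z) \<bullet> e))"
    using gradient_mean_value[OF \<Omega>(1,2) r0 \<Omega>(4) u e(1)] by (simp add: e(2))
  also have "\<dots> \<le> integral unit_cube (\<lambda>z. bump 2 z * norm (gradient u (x + r *\<^sub>R z)))"
  proof (rule integral_le)
    show "(\<lambda>z. bump 2 z * (gradient u (x + r *\<^sub>R z) \<bullet> e)) integrable_on unit_cube"
      by (intro integrable_continuous continuous_on_bump_scaled[OF _ sub r0] continuous_intros cg) simp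
    show "(\<lambda>z. bump 2 z * norm (gradient u (x + r *\<^sub>R z))) integrable_on unit_cube"
      by (intro integrable_continuous continuous_on_bump_scaled[OF _ sub r0] continuous_intros cg) simp
    fix z :: "real ^ 'n"
    have "gradient u (x + r *\<^sub>R z) \<bullet> e \<le> norm (gradient u (x + r *\<^sub>R z)) * norm e"
      by (rule norm_cauchy_schwarz)
    also have "\<dots> \<le> norm (gradient u (x + r *\<^sub>R z))"
      using e(1) by (simp add: mult_left_le)
    finally show "bump 2 z * (gradient u (x + r *\<^sub>R z) \<bullet> e) \<le> bump 2 z * norm (gradient u (x + r *\<^sub>R z))"
      by (intro mult_left_mono bump_nonneg)
  qed
  finally have "r ^ CARD('n) * (integral unit_cube (bump 2 :: real ^ 'n \<Rightarrow> real) * norm (gradient u x)) \<le>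
      r ^ CARD('n) * integral unit_cube (\<lambda>z. bump 2 z * norm (gradient u (x + r *\<^sub>R z)))"
    using r0 by (intro mult_left_mono) auto
  also have "\<dots> \<le> integral (ball x r) (\<lambda>y. norm (gradient u y))"
    using bump_average_le_integral_ball[OF continuous_on_norm[OF continuous_on_subset[OF cg sub]] norm_ge_zero \<Omega>(3), of 2]
    by simp
  finally show ?thesis .
qed

text \<open>In the mean value formula for the derivative in the direction of \<open>\<nabla>u x\<close>, integration by parts moves
  the derivative from \<open>u - a\<close> to the weight and gains a factor \<open>1 / r\<close>.\<close>
lemma gradient_estimate:
  fixes u :: "real ^ 'n::finite \<Rightarrow> real"
  assumes \<Omega>: "open \<Omega>" "cball x R \<subseteq> \<Omega>" "0 \<le> r" "r < R" and u: "harmonic_on \<Omega> u"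
    and M: "\<And>y. y \<in> cball x r \<Longrightarrow> \<bar>u y - a\<bar> \<le> M"
  shows "r * (integral unit_cube (bump 2 :: real ^ 'n \<Rightarrow> real) * norm (gradient u x)) \<le>
    4 * integral unit_cube (bump 1 :: real ^ 'n \<Rightarrow> real) * M"
proof -
  have sub: "cball x r \<subseteq> \<Omega>"
    using \<Omega> by auto
  note cg = harmonic_on_continuous_gradient[OF u]
  define e where "e = sgn (gradient u x)"
  have e: "norm e \<le> 1" "gradient u x \<bullet> e = norm (gradient u x)"
    by (simp_all add: e_def norm_sgn inner_sgn_self)
  have "r * (integral unit_cube (bump 2 :: real ^ 'n \<Rightarrow> real) * norm (gradient u x)) =
      r * integral unit_cube (\<lambda>z. bump 2 z * (gradient u (x + r *\<^sub>R z) \<bullet> e))"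
    using gradient_mean_value[OF \<Omega> u e(1)] by (simp add: e(2))
  also have "\<dots> = 4 * integral unit_cube (\<lambda>z. bump 1 z * ((z \<bullet> e) * (u (x + r *\<^sub>R z) - a)))"
  proof -
    have "((\<lambda>y. u y - a) has_derivative (\<lambda>h. gradient u y \<bullet> h)) (at y)" if "y \<in> \<Omega>" for y
      using harmonic_on_has_derivative[OF u that] by (auto intro!: derivative_eq_intros)
    then show ?thesis
      using bump_integration_by_parts[OF \<Omega>(1) sub \<Omega>(3) e(1), of 1 "\<lambda>y. u y - a" "\<lambda>y h. gradient u y \<bullet> h"]
        continuous_on_inner[OF cg continuous_on_const[of \<Omega> e]] by (simp add: numeral_eq_Suc)
  qed
  also have "\<dots> \<le> 4 * integral unit_cube (\<lambda>z :: real ^ 'n. bump 1 z * M)"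
  proof (rule mult_left_mono, rule integral_le)
    show "(\<lambda>z. bump 1 z * ((z \<bullet> e) * (u (x + r *\<^sub>R z) - a))) integrable_on unit_cube"
      by (intro integrable_continuous continuous_on_bump_mult)
         (auto intro!: continuous_intros continuous_on_compose2[OF harmonic_on_continuous[OF u]]
           scaled_unit_ball_subset[OF sub \<Omega>(3)])
    show "(\<lambda>z :: real ^ 'n. bump 1 z * M) integrable_on unit_cube"
      by (intro integrable_continuous continuous_intros)
    fix z :: "real ^ 'n"
    show "bump 1 z * ((z \<bullet> e) * (u (x + r *\<^sub>R z) - a)) \<le> bump 1 z * M"
    proof (cases "norm z \<le> 1")
      case True
      have "\<bar>z \<bullet> e\<bar> \<le> 1"
        using Cauchy_Schwarz_ineq2[of z e] mult_le_one[OF True norm_ge_zero e(1)] by linarith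
      then have "\<bar>(z \<bullet> e) * (u (x + r *\<^sub>R z) - a)\<bar> \<le> 1 * M"
        using M[OF scaled_unit_ball_subset[OF order_refl \<Omega>(3) True]]
        unfolding abs_mult by (intro mult_mono) auto
      then show ?thesis
        by (intro mult_left_mono bump_nonneg) auto
    qed (simp add: bump_eq_0)
  qed simp
  also have "\<dots> = 4 * integral unit_cube (bump 1 :: real ^ 'n \<Rightarrow> real) * M"
    by simp
  finally show ?thesis .
qed

section \<open>Sub-mean-value inequalities for powers\<close>

text \<open>Between the positive bounds \<open>\<epsilon> A\<close> and \<open>L A\<close> a power is monotone, so it is at most the sum of its
  values at the two bounds, whatever the sign of the exponent.\<close>
lemma powr_le_powr_between:
  fixes A t \<epsilon> L p :: real
  assumes "0 < \<epsilon>" "0 < A" "\<epsilon> * A \<le> t" "t \<le> L * A"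
  shows "t powr (1 - p) \<le> (\<epsilon> powr (1 - p) + L powr (1 - p)) * A powr (1 - p)"
proof -
  have t: "0 < \<epsilon> * A" "0 < t"
    using assms by (auto intro: less_le_trans[of 0 "\<epsilon> * A"])
  consider "p \<le> 1" | "1 \<le> p" by linarith
  then have "t powr (1 - p) \<le> (\<epsilon> * A) powr (1 - p) \<or> t powr (1 - p) \<le> (L * A) powr (1 - p)"
  proof cases
    case 1
    then show ?thesis
      using assms t by (intro disjI2 powr_mono2) auto
  next
    case 2
    then show ?thesis
      using assms t by (intro disjI1 powr_mono2') auto
  qed
  moreover have "(\<epsilon> * A) powr (1 - p) = \<epsilon> powr (1 - p) * A powr (1 - p)"
      "(L * A) powr (1 - p) = L powr (1 - p) * A powr (1 - p)"
    by (auto simp: powr_mult)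
  moreover have "0 \<le> \<epsilon> powr (1 - p) * A powr (1 - p)" "0 \<le> L powr (1 - p) * A powr (1 - p)"
    by auto
  ultimately show ?thesis
    unfolding distrib_right by linarith
qed

lemma measure_lebesgue_ball:
  fixes x :: "'a::euclidean_space"
  assumes "0 \<le> r"
  shows "measure lebesgue (ball x r) = unit_ball_vol (real DIM('a)) * r ^ DIM('a)"
  using content_ball[OF assms, of x] by (simp add: measure_completion)

lemma integral_ball_const:
  fixes x :: "'a::euclidean_space" and a :: real
  assumes "0 \<le> r"
  shows "integral (ball x r) (\<lambda>_. a) = a * (unit_ball_vol (real DIM('a)) * r ^ DIM('a))"
proof -
  have "integral (ball x r) (\<lambda>_. a * 1) = a * integral (ball x r) (\<lambda>_. 1)"
    by (rule integral_mult_right)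
  then show ?thesis
    using lmeasure_integral[OF lmeasurable_ball, of x r] measure_lebesgue_ball[OF assms, of x] by simp
qed

text \<open>A sub-mean-value inequality for \<open>v\<close> passes to \<open>v\<^sup>p\<close>, with a worse constant, for every \<open>p > 0\<close>; this is
  an argument of Hardy and Littlewood. Choose \<open>y\<^sub>0\<close> where \<open>(R - |y - x|)\<^sup>n v(y)\<^sup>p\<close> is maximal and put
  \<open>A = v(y\<^sub>0)\<close>. In the ball around \<open>y\<^sub>0\<close> whose radius \<open>s\<close> is half the distance to the sphere of
  radius \<open>R\<close>, the maximality gives \<open>v \<le> L A\<close> with a constant \<open>L\<close>. For \<open>0 \<le> t \<le> L A\<close> one has
  \<open>t \<le> \<epsilon> A + m A\<^sup>1\<^sup>-\<^sup>p t\<^sup>p\<close>; inserting this into the inequality for \<open>v\<close> at \<open>y\<^sub>0\<close> and absorbing the first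
  term bounds \<open>s\<^sup>n A\<^sup>p\<close>, hence the maximum, hence its competitor \<open>R\<^sup>n v(x)\<^sup>p\<close> at the centre.\<close>
lemma sub_mean_value_powr:
  fixes p c :: real
  assumes p: "0 < p" and c: "0 < c"
  obtains K where "0 < K"
    and "\<And>(v :: 'a::euclidean_space \<Rightarrow> real) x R.
      \<lbrakk>0 < R; continuous_on (cball x R) v; \<And>y. y \<in> cball x R \<Longrightarrow> 0 \<le> v y;
       \<And>y s. \<lbrakk>0 < s; cball y s \<subseteq> ball x R\<rbrakk> \<Longrightarrow> s ^ DIM('a) * v y \<le> c * integral (ball y s) v\<rbrakk>
      \<Longrightarrow> R ^ DIM('a) * v x powr p \<le> K * integral (ball x R) (\<lambda>y. v y powr p)"
proof -
  define n where "n = DIM('a)"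
  have n: "0 < n"
    by (simp add: n_def)
  define \<beta> where "\<beta> = unit_ball_vol (real n)"
  have \<beta>: "0 < \<beta>"
    by (simp add: \<beta>_def)
  \<comment> \<open>With this \<open>\<epsilon>\<close> the term \<open>\<epsilon> A\<close> contributes exactly half of the left-hand side and can be absorbed.\<close>
  define \<epsilon> where "\<epsilon> = 1 / (2 * c * \<beta>)"
  have \<epsilon>: "0 < \<epsilon>" "c * (\<epsilon> * \<beta>) = 1 / 2"
    using c \<beta> by (auto simp: \<epsilon>_def)
  \<comment> \<open>The factor \<open>R - |y - x|\<close> is at least half as large in the small ball as at \<open>y\<^sub>0\<close>, so \<open>v\<^sup>p\<close> is
      at most \<open>2\<^sup>n\<close> times as large.\<close>
  define L :: real where "L = 2 powr (real n / p)"
  have L: "0 < L" "L powr p = 2 ^ n"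
    using p by (auto simp: L_def powr_powr powr_realpow)
  define m where "m = \<epsilon> powr (1 - p) + L powr (1 - p)"
  have m: "0 < m"
    using \<epsilon> L by (simp add: m_def add_pos_pos)
  define K where "K = 2 ^ n * (2 * c * m)"
  have K: "0 < K"
    using c m by (simp add: K_def)
  have split: "t \<le> \<epsilon> * A + m * A powr (1 - p) * t powr p" if "0 < A" "0 \<le> t" "t \<le> L * A" for A t
  proof (cases "t \<le> \<epsilon> * A")
    case True
    have "0 \<le> m * A powr (1 - p) * t powr p"
      using m by simp
    with True show ?thesis by linarith
  next
    case False
    then have t: "0 < t"
      using that \<epsilon>(1) mult_pos_pos[of \<epsilon> A] by linarith
    have "t = t powr (1 - p) * t powr p"
      using t by (simp add: powr_add[symmetric])
    also have "\<dots> \<le> (m * A powr (1 - p)) * t powr p"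
      using powr_le_powr_between[of \<epsilon> A t L p] False that \<epsilon>(1) by (intro mult_right_mono) (auto simp: m_def)
    also have "\<dots> \<le> \<epsilon> * A + (m * A powr (1 - p)) * t powr p"
      using \<epsilon>(1) that by simp
    finally show ?thesis .
  qed
  have "R ^ n * v x powr p \<le> K * integral (ball x R) (\<lambda>y. v y powr p)"
    if R: "0 < R" and cont: "continuous_on (cball x R) v" and v0: "\<And>y. y \<in> cball x R \<Longrightarrow> 0 \<le> v y"
      and sub: "\<And>y s. \<lbrakk>0 < s; cball y s \<subseteq> ball x R\<rbrakk> \<Longrightarrow> s ^ n * v y \<le> c * integral (ball y s) v"
    for v :: "'a \<Rightarrow> real" and x R
  proof -
    have contp: "continuous_on (cball x R) (\<lambda>y. v y powr p)"
      using p v0 by (intro continuous_on_powr' cont continuous_on_const) auto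
    let ?I = "integral (ball x R) (\<lambda>y. v y powr p)"
    have intp: "(\<lambda>y. v y powr p) integrable_on ball y s" if "cball y s \<subseteq> cball x R" for y s
      by (intro set_lebesgue_integral_eq_integral(1) continuous_on_ball_integrable continuous_on_subset[OF contp that])
    have I0: "0 \<le> ?I"
      by (intro integral_nonneg intp) auto
    define w where "w y = (R - dist x y) ^ n * v y powr p" for y
    have "continuous_on (cball x R) w"
      unfolding w_def by (intro continuous_intros contp)
    then obtain y0 where y0: "y0 \<in> cball x R" and max: "\<And>y. y \<in> cball x R \<Longrightarrow> w y \<le> w y0"
      using continuous_attains_sup[of "cball x R" w] R by auto
    have wx: "R ^ n * v x powr p \<le> w y0"
      using max[of x] R by (simp add: w_def)
    show ?thesis
    proof (cases "w y0 \<le> 0")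
      case True
      then show ?thesis
        using wx mult_nonneg_nonneg[OF less_imp_le[OF K] I0] by linarith
    next
      case False
      define A where "A = v y0"
      have A: "0 < A"
      proof (rule ccontr)
        assume "\<not> 0 < A"
        then have "v y0 = 0" using v0[OF y0] by (simp add: A_def)
        with False show False by (simp add: w_def)
      qed
      define s where "s = (R - dist x y0) / 2"
      have s: "0 < s"
      proof (rule ccontr)
        assume "\<not> 0 < s"
        then have "R - dist x y0 = 0" using y0 by (simp add: s_def)
        with False n show False by (simp add: w_def zero_power)
      qed
      have wy0: "w y0 = 2 ^ n * (s ^ n * A powr p)"
        by (simp add: w_def A_def s_def power_divide)
      have ball: "cball y0 s \<subseteq> ball x R"
      proof
        fix y assume "y \<in> cball y0 s"
        then have "dist x y \<le> dist x y0 + s"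
          using dist_triangle[of x y y0] by simp
        then show "y \<in> ball x R"
          using s by (simp add: s_def field_simps)
      qed
      then have cball: "cball y0 s \<subseteq> cball x R"
        using ball_subset_cball by blast
      have vL: "v y \<le> L * A" if "y \<in> ball y0 s" for y
      proof (rule ccontr)
        assume "\<not> v y \<le> L * A"
        then have less: "L * A < v y" by simp
        have y: "y \<in> cball x R" using that cball ball_subset_cball by blast
        have "dist x y \<le> dist x y0 + s"
          using that dist_triangle[of x y y0] by simp
        then have "s \<le> R - dist x y"
          by (simp add: s_def field_simps)
        then have "s ^ n * v y powr p \<le> w y"
          unfolding w_def using s by (intro mult_right_mono power_mono) auto
        also have "\<dots> \<le> w y0"
          using max y by blast
        also have "\<dots> = s ^ n * (L * A) powr p"
          using L A by (simp add: wy0 powr_mult)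
        finally have "v y powr p \<le> (L * A) powr p"
          using s by simp
        moreover have "(L * A) powr p < v y powr p"
          using less L A p by (intro powr_less_mono2) auto
        ultimately show False by simp
      qed
      have "s ^ n * A \<le> c * integral (ball y0 s) v"
        using sub[OF s ball] by (simp add: A_def)
      also have "integral (ball y0 s) v \<le> integral (ball y0 s) (\<lambda>y. \<epsilon> * A + m * A powr (1 - p) * v y powr p)"
      proof (rule integral_le)
        show "v integrable_on ball y0 s"
          by (intro set_lebesgue_integral_eq_integral(1) continuous_on_ball_integrable continuous_on_subset[OF cont cball])
        show "(\<lambda>y. \<epsilon> * A + m * A powr (1 - p) * v y powr p) integrable_on ball y0 s"
          by (intro set_lebesgue_integral_eq_integral(1) continuous_on_ball_integrable continuous_on_add
              continuous_on_mult continuous_on_const continuous_on_subset[OF contp cball])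
        show "v y \<le> \<epsilon> * A + m * A powr (1 - p) * v y powr p" if "y \<in> ball y0 s" for y
        proof -
          have "y \<in> cball x R" using that cball ball_subset_cball by blast
          from split[OF A v0[OF this] vL[OF that]] show ?thesis .
        qed
      qed
      also have "\<dots> = \<epsilon> * A * (\<beta> * s ^ n) + m * A powr (1 - p) * integral (ball y0 s) (\<lambda>y. v y powr p)"
      proof -
        have "integral (ball y0 s) (\<lambda>y. \<epsilon> * A + m * A powr (1 - p) * v y powr p) =
            integral (ball y0 s) (\<lambda>y. \<epsilon> * A) + integral (ball y0 s) (\<lambda>y. m * A powr (1 - p) * v y powr p)"
          by (intro integral_add integrable_on_mult_right intp cball integrable_on_const lmeasurable_ball)
        then show ?thesis
          using integral_ball_const[of s y0 "\<epsilon> * A"] s by (simp add: \<beta>_def n_def)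
      qed
      also have "integral (ball y0 s) (\<lambda>y. v y powr p) \<le> ?I"
        using ball by (intro integral_subset_le intp cball) (auto intro: order_trans[OF ball_subset_cball])
      finally have "s ^ n * A \<le> c * (\<epsilon> * A * (\<beta> * s ^ n) + m * A powr (1 - p) * ?I)"
        using c m by (simp add: mult_left_mono)
      also have "\<dots> = (c * (\<epsilon> * \<beta>)) * (s ^ n * A) + c * m * A powr (1 - p) * ?I"
        by (simp add: algebra_simps)
      finally have "s ^ n * A \<le> 2 * c * m * A powr (1 - p) * ?I"
        unfolding \<epsilon>(2) by simp
      then have "s ^ n * A * A powr (p - 1) \<le> 2 * c * m * A powr (1 - p) * ?I * A powr (p - 1)"
        by (rule mult_right_mono) simp
      then have "s ^ n * (A * A powr (p - 1)) \<le> 2 * c * m * ?I * (A powr (1 - p) * A powr (p - 1))"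
        by (simp only: ac_simps)
      moreover have "A * A powr (p - 1) = A powr p" "A powr (1 - p) * A powr (p - 1) = 1"
        using A by (auto simp: powr_mult_base powr_add[symmetric])
      ultimately have "s ^ n * A powr p \<le> 2 * c * m * ?I"
        by simp
      then have "w y0 \<le> K * ?I"
        unfolding wy0 K_def by (simp add: mult.assoc)
      with wx show ?thesis by linarith
    qed
  qed
  with K show thesis
    using that unfolding n_def by blast
qed

text \<open>The constant depends on the dimension and on \<open>p\<close> only. This is what remains of the subharmonicity of
  \<open>|\<nabla>u|\<^sup>p\<close> for exponents \<open>p\<close> close to zero.\<close>
lemma gradient_powr_sub_mean_value:
  fixes p :: real
  assumes "0 < p"
  obtains K where "0 < K"
    and "\<And>\<Omega> (u :: real ^ 'n::finite \<Rightarrow> real) x R.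
      \<lbrakk>open \<Omega>; harmonic_on \<Omega> u; 0 < R; cball x R \<subseteq> \<Omega>\<rbrakk>
      \<Longrightarrow> R ^ CARD('n) * norm (gradient u x) powr p \<le> K * integral (ball x R) (\<lambda>y. norm (gradient u y) powr p)"
proof -
  let ?\<kappa> = "integral unit_cube (bump 2 :: real ^ 'n \<Rightarrow> real)"
  have \<kappa>: "0 < ?\<kappa>"
    by (rule integral_bump_pos)
  obtain K where K: "0 < K" and powr: "\<And>(v :: real ^ 'n \<Rightarrow> real) x R.
      \<lbrakk>0 < R; continuous_on (cball x R) v; \<And>y. y \<in> cball x R \<Longrightarrow> 0 \<le> v y;
       \<And>y s. \<lbrakk>0 < s; cball y s \<subseteq> ball x R\<rbrakk> \<Longrightarrow> s ^ DIM(real ^ 'n) * v y \<le> 1 / ?\<kappa> * integral (ball y s) v\<rbrakk>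
      \<Longrightarrow> R ^ DIM(real ^ 'n) * v x powr p \<le> K * integral (ball x R) (\<lambda>y. v y powr p)"
    using sub_mean_value_powr[OF assms, of "1 / ?\<kappa>", where ?'a = "real ^ 'n"] \<kappa> by (metis zero_less_divide_1_iff)
  have "R ^ CARD('n) * norm (gradient u x) powr p \<le> K * integral (ball x R) (\<lambda>y. norm (gradient u y) powr p)"
    if \<Omega>: "open \<Omega>" and u: "harmonic_on \<Omega> u" and R: "0 < R" "cball x R \<subseteq> \<Omega>"
    for \<Omega> and u :: "real ^ 'n \<Rightarrow> real" and x R
  proof -
    have "s ^ CARD('n) * norm (gradient u y) \<le> 1 / ?\<kappa> * integral (ball y s) (\<lambda>y. norm (gradient u y))"
      if s: "0 < s" "cball y s \<subseteq> ball x R" for y s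
    proof -
      have "cball y (R - dist y x) \<subseteq> \<Omega>" "s < R - dist y x"
        using s R(2) cball_subset_ball_iff[of y s x R] cball_subset_cball_iff[of y "R - dist y x" x R] by auto
      from gradient_sub_mean_value[OF \<Omega> this(1) s(1) this(2) u] \<kappa> show ?thesis
        by (simp add: field_simps)
    qed
    then show ?thesis
      using powr[of R x "\<lambda>y. norm (gradient u y)"] R
        continuous_on_norm[OF continuous_on_subset[OF harmonic_on_continuous_gradient[OF u] R(2)]] by simp
  qed
  with K show thesis
    using that by blast
qed

section \<open>Boundary distance and majorants\<close>
lemma proper_subdomain_bdist_pos:
  assumes "proper_subdomain \<Omega>" "x \<in> \<Omega>"
  shows "0 < bdist \<Omega> x"
proof -
  have "frontier \<Omega> \<noteq> {}"
    using assms by (auto simp: proper_subdomain_def frontier_eq_empty)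
  moreover have "x \<notin> frontier \<Omega>"
    using assms frontier_disjoint_eq[of \<Omega>] by (auto simp: proper_subdomain_def)
  ultimately show ?thesis
    unfolding bdist_def by (intro infdist_pos_not_in_closed) auto
qed

text \<open>A ball is connected, so it cannot leave the domain without meeting the boundary.\<close>
lemma cball_subset_domain:
  assumes "x \<in> \<Omega>" "0 \<le> r" "r < bdist \<Omega> x"
  shows "cball x r \<subseteq> \<Omega>"
proof (rule ccontr)
  assume "\<not> cball x r \<subseteq> \<Omega>"
  then have "cball x r \<inter> frontier \<Omega> \<noteq> {}"
    using assms centre_in_cball[of x r] by (intro connected_Int_frontier) blast+
  then obtain z where "z \<in> frontier \<Omega>" "dist x z \<le> r"
    by auto
  then show False
    using infdist_le[of z "frontier \<Omega>" x] assms by (simp add: bdist_def)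
qed

lemma bdist_le: "bdist \<Omega> x \<le> bdist \<Omega> y + dist x y"
  unfolding bdist_def by (rule infdist_triangle)

lemma nearest_frontier_point:
  assumes "proper_subdomain \<Omega>"
  obtains \<zeta> where "\<zeta> \<in> frontier \<Omega>" "dist x \<zeta> = bdist \<Omega> x"
proof -
  have "frontier \<Omega> \<noteq> {}"
    using assms by (auto simp: proper_subdomain_def frontier_eq_empty)
  then obtain \<zeta> where "\<zeta> \<in> frontier \<Omega>" "infdist x (frontier \<Omega>) = dist x \<zeta>"
    using infdist_attains_inf[OF frontier_closed] by blast
  then show thesis
    by (intro that[of \<zeta>]) (simp_all add: bdist_def)
qed

lemma majorant_nonneg: "majorant \<psi> \<Longrightarrow> 0 \<le> t \<Longrightarrow> 0 \<le> \<psi> t"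
  by (auto simp: majorant_def)

lemma majorant_mono: "majorant \<psi> \<Longrightarrow> 0 \<le> s \<Longrightarrow> s \<le> t \<Longrightarrow> \<psi> s \<le> \<psi> t"
  by (auto simp: majorant_def mono_on_def)

lemma majorant_ratio_antimono: "majorant \<psi> \<Longrightarrow> 0 < s \<Longrightarrow> s \<le> t \<Longrightarrow> \<psi> t / t \<le> \<psi> s / s"
  by (auto simp: majorant_def monotone_on_def)

lemma majorant_double:
  assumes "majorant \<psi>" "0 < t"
  shows "\<psi> (2 * t) \<le> 2 * \<psi> t"
  using majorant_ratio_antimono[of \<psi> t "2 * t"] assms by (simp add: field_simps)

section \<open>Lipschitz classes and growth of the gradient\<close>

text \<open>Let \<open>\<delta> = |x - y|\<close> be less than half the boundary distance of \<open>x\<close>. On the ball of radius \<open>\<delta>\<close> around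
  \<open>x\<close> the boundary distance is at least \<open>\<delta>\<close>, so \<open>|\<nabla>u| \<le> C \<psi> \<delta> / \<delta>\<close> there because \<open>\<psi> t / t\<close> is
  non-increasing. The mean value theorem yields \<open>C \<psi> \<delta>\<close>.\<close>
lemma gradient_bound_imp_locLip:
  assumes \<psi>: "majorant \<psi>" and \<Omega>: "proper_subdomain \<Omega>" and u: "harmonic_on \<Omega> u"
    and C: "0 < C" "\<And>x. x \<in> \<Omega> \<Longrightarrow> norm (gradient u x) \<le> C * (\<psi> (bdist \<Omega> x) / bdist \<Omega> x)"
  shows "u \<in> locLip \<psi> \<Omega>"
proof -
  have "norm (u x - u y) \<le> C * \<psi> (dist x y)" if x: "x \<in> \<Omega>" and y: "dist x y < bdist \<Omega> x / 2" for x y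
  proof (cases "x = y")
    case True
    then show ?thesis
      using C(1) majorant_nonneg[OF \<psi>, of 0] by simp
  next
    case False
    define \<delta> where "\<delta> = dist x y"
    have \<delta>: "0 < \<delta>" using False by (simp add: \<delta>_def)
    have sub: "cball x \<delta> \<subseteq> \<Omega>"
      using y proper_subdomain_bdist_pos[OF \<Omega> x] by (intro cball_subset_domain[OF x]) (auto simp: \<delta>_def)
    have "norm (u x - u y) \<le> C * (\<psi> \<delta> / \<delta>) * norm (x - y)"
    proof (rule differentiable_bound[of "cball x \<delta>" u "\<lambda>z h. gradient u z \<bullet> h"])
      fix z assume z: "z \<in> cball x \<delta>"
      with sub have z\<Omega>: "z \<in> \<Omega>" by blast
      show "(u has_derivative (\<lambda>h. gradient u z \<bullet> h)) (at z within cball x \<delta>)"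
        by (rule has_derivative_at_withinI[OF harmonic_on_has_derivative[OF u z\<Omega>]])
      have "\<delta> \<le> bdist \<Omega> z"
        using bdist_le[of \<Omega> x z] z y by (simp add: \<delta>_def)
      then have "\<psi> (bdist \<Omega> z) / bdist \<Omega> z \<le> \<psi> \<delta> / \<delta>"
        by (rule majorant_ratio_antimono[OF \<psi> \<delta>])
      then have "norm (gradient u z) \<le> C * (\<psi> \<delta> / \<delta>)"
        using C(2)[OF z\<Omega>] C(1) by (meson mult_left_mono less_imp_le order_trans)
      moreover have "onorm (\<lambda>h. gradient u z \<bullet> h) \<le> norm (gradient u z)"
        by (rule onorm_le) (simp add: Cauchy_Schwarz_ineq2)
      ultimately show "onorm (\<lambda>h. gradient u z \<bullet> h) \<le> C * (\<psi> \<delta> / \<delta>)"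
        by linarith
    qed (use \<delta> in \<open>auto simp: \<delta>_def\<close>)
    then show ?thesis
      using \<delta> by (simp add: \<delta>_def dist_norm)
  qed
  then show ?thesis
    using C(1) unfolding locLip_def by blast
qed

lemma extension_domain_real:
  fixes u :: "'a::euclidean_space \<Rightarrow> real"
  assumes "extension_domain \<psi> \<Omega>" "u \<in> locLip \<psi> \<Omega>"
  shows "u \<in> Lip \<psi> \<Omega>"
proof -
  have norm: "norm (complex_of_real (u x) - complex_of_real (u y)) = norm (u x - u y)" for x y
    by (metis norm_of_real of_real_diff real_norm_def)
  have "(\<lambda>x. complex_of_real (u x)) \<in> locLip \<psi> \<Omega>"
    using assms(2) unfolding locLip_def norm mem_Collect_eq .
  then have "(\<lambda>x. complex_of_real (u x)) \<in> Lip \<psi> \<Omega>"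
    using assms(1) by (simp add: extension_domain_def)
  then show ?thesis
    unfolding Lip_def norm mem_Collect_eq .
qed

lemma Lip_abs: "u \<in> Lip \<psi> \<Omega> \<Longrightarrow> (\<lambda>x. \<bar>u x\<bar> :: real) \<in> Lip \<psi> \<Omega>"
  unfolding Lip_def mem_Collect_eq real_norm_def by (meson abs_triangle_ineq3 order_trans)

text \<open>Functions in the Lipschitz class are uniformly continuous, since \<open>\<psi>\<close> is continuous at zero, and
  therefore extend to the closure; the inequality survives in the limit.\<close>
lemma Lip_extends_to_frontier:
  fixes f :: "'a::euclidean_space \<Rightarrow> 'b::banach"
  assumes \<psi>: "majorant \<psi>" and f: "f \<in> Lip \<psi> \<Omega>"
  shows "\<exists>F. (\<forall>x\<in>\<Omega>. F x = f x) \<and> F \<in> Lip2 \<psi> \<Omega> (frontier \<Omega>)"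
proof -
  obtain C where C: "0 < C" "\<And>x y. x \<in> \<Omega> \<Longrightarrow> y \<in> \<Omega> \<Longrightarrow> norm (f x - f y) \<le> C * \<psi> (dist x y)"
    using f unfolding Lip_def by blast
  have cont\<psi>: "continuous_on {0..} \<psi>" and "\<psi> 0 = 0"
    using \<psi> by (auto simp: majorant_def)
  have uc: "uniformly_continuous_on \<Omega> f"
    unfolding uniformly_continuous_on_def
  proof (intro allI impI)
    fix e :: real assume e: "0 < e"
    obtain d where d: "0 < d" "\<And>t. t \<in> {0..} \<Longrightarrow> dist t 0 < d \<Longrightarrow> dist (\<psi> t) (\<psi> 0) < e / C"
      using cont\<psi>[unfolded continuous_on_iff, rule_format, of 0 "e / C"] e C(1) by auto
    have "dist (f y) (f x) < e" if "x \<in> \<Omega>" "y \<in> \<Omega>" "dist y x < d" for x y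
    proof -
      have "\<psi> (dist y x) < e / C"
        using d(2)[of "dist y x"] that \<open>\<psi> 0 = 0\<close> by (auto simp: dist_real_def)
      then have "C * \<psi> (dist y x) < e"
        using C(1) by (simp add: field_simps)
      with C(2)[OF that(2,1)] show ?thesis
        by (simp add: dist_norm)
    qed
    with d(1) show "\<exists>d>0. \<forall>x\<in>\<Omega>. \<forall>y\<in>\<Omega>. dist y x < d \<longrightarrow> dist (f y) (f x) < e"
      by blast
  qed
  obtain F where F: "uniformly_continuous_on (closure \<Omega>) F" "\<And>x. x \<in> \<Omega> \<Longrightarrow> f x = F x"
    by (rule uniformly_continuous_on_extension_on_closure[OF uc]) (rule that)
  have cF: "continuous_on (closure \<Omega>) F"
    using F(1) by (rule uniformly_continuous_imp_continuous)
  have "norm (F x - F y) \<le> C * \<psi> (dist x y)" if x: "x \<in> \<Omega>" and y: "y \<in> frontier \<Omega>" for x y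
  proof -
    have "norm (F x - F y) - C * \<psi> (dist x y) \<le> 0"
    proof (rule continuous_le_on_closure[where S = \<Omega> and f = "\<lambda>y. norm (F x - F y) - C * \<psi> (dist x y)"])
      show "continuous_on (closure \<Omega>) (\<lambda>y. norm (F x - F y) - C * \<psi> (dist x y))"
        by (intro continuous_intros cF continuous_on_compose2[OF cont\<psi>]) auto
      show "y \<in> closure \<Omega>"
        using y by (simp add: frontier_def)
      show "norm (F x - F y) - C * \<psi> (dist x y) \<le> 0" if "y \<in> \<Omega>" for y
        using C(2)[OF x that] F(2)[OF x] F(2)[OF that] by simp
    qed
    then show ?thesis by simp
  qed
  then have "F \<in> Lip2 \<psi> \<Omega> (frontier \<Omega>)"
    using C(1) cF unfolding Lip2_def closure_Un_frontier by blast
  with F(2) show ?thesis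
    by (intro exI[of _ F]) auto
qed

text \<open>The nearest boundary point \<open>\<zeta>\<close> of \<open>x\<close> is within \<open>2 d(x)\<close> of every point of the ball, and
  \<open>F y\<close> and \<open>F x\<close> are compared through \<open>F \<zeta>\<close>. Doubling the argument at most doubles a majorant.\<close>
lemma Lip2_frontier_oscillation:
  assumes \<psi>: "majorant \<psi>" and \<Omega>: "proper_subdomain \<Omega>" and F: "F \<in> Lip2 \<psi> \<Omega> (frontier \<Omega>)"
  obtains C where "0 < C"
    and "\<And>x y. \<lbrakk>x \<in> \<Omega>; y \<in> cball x (bdist \<Omega> x / 2)\<rbrakk> \<Longrightarrow> norm (F y - F x) \<le> C * \<psi> (bdist \<Omega> x)"
proof -
  obtain C where C: "0 < C" "\<And>x y. x \<in> \<Omega> \<Longrightarrow> y \<in> frontier \<Omega> \<Longrightarrow> norm (F x - F y) \<le> C * \<psi> (dist x y)"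
    using F unfolding Lip2_def by blast
  have "norm (F y - F x) \<le> 3 * C * \<psi> (bdist \<Omega> x)" if x: "x \<in> \<Omega>" and y: "y \<in> cball x (bdist \<Omega> x / 2)" for x y
  proof -
    let ?d = "bdist \<Omega> x"
    have d: "0 < ?d"
      by (rule proper_subdomain_bdist_pos[OF \<Omega> x])
    have y\<Omega>: "y \<in> \<Omega>"
      using cball_subset_domain[OF x, of "?d / 2"] d y by auto
    obtain \<zeta> where \<zeta>: "\<zeta> \<in> frontier \<Omega>" "dist x \<zeta> = ?d"
      using nearest_frontier_point[OF \<Omega>] by blast
    have "dist y \<zeta> \<le> 2 * ?d"
      using dist_triangle[of y \<zeta> x] y \<zeta>(2) d by (simp add: dist_commute)
    then have "\<psi> (dist y \<zeta>) \<le> 2 * \<psi> ?d"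
      using majorant_mono[OF \<psi>, of "dist y \<zeta>" "2 * ?d"] majorant_double[OF \<psi> d] by simp
    then have "norm (F y - F \<zeta>) \<le> C * (2 * \<psi> ?d)"
      using C(2)[OF y\<Omega> \<zeta>(1)] C(1) by (meson mult_left_mono less_imp_le order_trans)
    moreover have "norm (F x - F \<zeta>) \<le> C * \<psi> ?d"
      using C(2)[OF x \<zeta>(1)] \<zeta>(2) by simp
    moreover have "norm (F y - F x) \<le> norm (F y - F \<zeta>) + norm (F x - F \<zeta>)"
      using norm_triangle_ineq4[of "F y - F \<zeta>" "F x - F \<zeta>"] by simp
    ultimately show ?thesis by linarith
  qed
  with C(1) show thesis
    by (intro that[of "3 * C"]) auto
qed

text \<open>This is where information on \<open>|u|\<close> becomes information on \<open>u\<close>. Either \<open>u\<close> has a zero in \<open>S\<close>, and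
  then \<open>|u|\<close> itself is small (take \<open>a = 0\<close>), or \<open>u\<close> keeps one sign on the connected set \<open>S\<close>, and then
  \<open>|u|\<close> oscillates exactly as \<open>u\<close> does (take \<open>a = u x\<close>).\<close>
lemma deviation_le_of_abs_oscillation:
  fixes u :: "'a::topological_space \<Rightarrow> real"
  assumes S: "connected S" "x \<in> S" and u: "continuous_on S u"
    and M: "\<And>y. y \<in> S \<Longrightarrow> \<bar>\<bar>u y\<bar> - \<bar>u x\<bar>\<bar> \<le> M"
  obtains a where "\<And>y. y \<in> S \<Longrightarrow> \<bar>u y - a\<bar> \<le> 2 * M"
proof (cases "\<exists>z\<in>S. u z = 0")
  case True
  then have "\<bar>u x\<bar> \<le> M"
    using M by force
  then have "\<bar>u y - 0\<bar> \<le> 2 * M" if "y \<in> S" for y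
    using M[OF that] by linarith
  then show thesis by (rule that)
next
  case False
  have "\<bar>u y - u x\<bar> \<le> 2 * M" if y: "y \<in> S" for y
  proof -
    have c: "connected (u ` S)"
      using u S(1) by (rule connected_continuous_image)
    have "0 \<notin> u ` S"
      using False by auto
    then have "\<not> (u x \<le> 0 \<and> 0 \<le> u y)" "\<not> (u y \<le> 0 \<and> 0 \<le> u x)"
      using connectedD_interval[OF c] S(2) y by blast+
    then show ?thesis
      using M[OF y] by linarith
  qed
  then show thesis by (rule that)
qed

lemma abs_oscillation_imp_gradient_bound:
  fixes u :: "real ^ 'n::finite \<Rightarrow> real"
  assumes \<Omega>: "proper_subdomain \<Omega>" and u: "harmonic_on \<Omega> u" and C: "0 < C"
    and osc: "\<And>x y. \<lbrakk>x \<in> \<Omega>; y \<in> cball x (bdist \<Omega> x / 2)\<rbrakk> \<Longrightarrow> \<bar>\<bar>u y\<bar> - \<bar>u x\<bar>\<bar> \<le> C * \<psi> (bdist \<Omega> x)"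
  shows "\<exists>C>0. \<forall>x\<in>\<Omega>. norm (gradient u x) \<le> C * (\<psi> (bdist \<Omega> x) / bdist \<Omega> x)"
proof -
  let ?\<kappa>2 = "integral unit_cube (bump 2 :: real ^ 'n \<Rightarrow> real)"
  let ?\<kappa>1 = "integral unit_cube (bump 1 :: real ^ 'n \<Rightarrow> real)"
  have \<kappa>: "0 < ?\<kappa>2" "0 < ?\<kappa>1"
    by (rule integral_bump_pos)+
  have "norm (gradient u x) \<le> 16 * ?\<kappa>1 / ?\<kappa>2 * C * (\<psi> (bdist \<Omega> x) / bdist \<Omega> x)" if x: "x \<in> \<Omega>" for x
  proof -
    let ?d = "bdist \<Omega> x"
    have d: "0 < ?d"
      by (rule proper_subdomain_bdist_pos[OF \<Omega> x])
    have sub: "cball x (?d / 2) \<subseteq> \<Omega>" "cball x (3 * ?d / 4) \<subseteq> \<Omega>"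
      using d by (simp_all add: cball_subset_domain[OF x])
    obtain a where a: "\<And>y. y \<in> cball x (?d / 2) \<Longrightarrow> \<bar>u y - a\<bar> \<le> 2 * (C * \<psi> ?d)"
      using deviation_le_of_abs_oscillation[of "cball x (?d / 2)" x u "C * \<psi> ?d"] d osc[OF x]
        continuous_on_subset[OF harmonic_on_continuous[OF u] sub(1)] by auto
    have "?d / 2 * (?\<kappa>2 * norm (gradient u x)) \<le> 4 * ?\<kappa>1 * (2 * (C * \<psi> ?d))"
      using \<Omega> d by (intro gradient_estimate[OF _ sub(2) _ _ u a]) (auto simp: proper_subdomain_def)
    then show ?thesis
      using d \<kappa> by (simp add: field_simps)
  qed
  moreover have "0 < 16 * ?\<kappa>1 / ?\<kappa>2 * C"
    using \<kappa> C by simp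
  ultimately show ?thesis
    by blast
qed

lemma grad_mean_eq:
  fixes u :: "real ^ 'n::finite \<Rightarrow> real"
  assumes \<Omega>: "proper_subdomain \<Omega>" and u: "harmonic_on \<Omega> u" and p: "0 < p" and x: "x \<in> \<Omega>"
  defines "r \<equiv> bdist \<Omega> x / 2"
  shows "grad_mean \<Omega> u p x =
    (integral (ball x r) (\<lambda>y. norm (gradient u y) powr p) / (unit_ball_vol (real CARD('n)) * r ^ CARD('n))) powr (1 / p)"
    and "(\<lambda>y. norm (gradient u y) powr p) integrable_on ball x r"
proof -
  have r: "0 \<le> r" "cball x r \<subseteq> \<Omega>"
    using proper_subdomain_bdist_pos[OF \<Omega> x] by (simp_all add: r_def cball_subset_domain[OF x])
  have "continuous_on (cball x r) (\<lambda>y. norm (gradient u y) powr p)"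
    using p by (intro continuous_on_powr' continuous_on_const continuous_on_norm
        continuous_on_subset[OF harmonic_on_continuous_gradient[OF u] r(2)]) auto
  then have abs: "(\<lambda>y. norm (gradient u y) powr p) absolutely_integrable_on ball x r"
    by (rule continuous_on_ball_integrable)
  then show "(\<lambda>y. norm (gradient u y) powr p) integrable_on ball x r"
    by (rule set_lebesgue_integral_eq_integral(1))
  show "grad_mean \<Omega> u p x =
    (integral (ball x r) (\<lambda>y. norm (gradient u y) powr p) / (unit_ball_vol (real CARD('n)) * r ^ CARD('n))) powr (1 / p)"
    using measure_lebesgue_ball[OF r(1), of x] set_lebesgue_integral_eq_integral(2)[OF abs]
    by (simp add: grad_mean_def r_def)
qed

text \<open>On the ball of radius \<open>d(x) / 2\<close> the boundary distance is at least \<open>d(x) / 2\<close>, and the growth bound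
  at that distance exceeds the one at distance \<open>d(x)\<close> by a factor of at most 2.\<close>
lemma gradient_bound_imp_grad_mean_bound:
  fixes u :: "real ^ 'n::finite \<Rightarrow> real"
  assumes \<psi>: "majorant \<psi>" and \<Omega>: "proper_subdomain \<Omega>" and u: "harmonic_on \<Omega> u" and p: "0 < p" and x: "x \<in> \<Omega>"
    and C: "0 < C" "\<And>x. x \<in> \<Omega> \<Longrightarrow> norm (gradient u x) \<le> C * (\<psi> (bdist \<Omega> x) / bdist \<Omega> x)"
  shows "grad_mean \<Omega> u p x \<le> 2 * C * (\<psi> (bdist \<Omega> x) / bdist \<Omega> x)"
proof -
  define d where "d = bdist \<Omega> x"
  define r where "r = d / 2"
  define B where "B = 2 * C * (\<psi> d / d)"
  have d: "0 < d" and r: "0 < r" "d = 2 * r"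
    using proper_subdomain_bdist_pos[OF \<Omega> x] by (auto simp: d_def r_def)
  have B: "0 \<le> B"
    using C(1) d majorant_nonneg[OF \<psi>, of d] by (simp add: B_def)
  have sub: "cball x r \<subseteq> \<Omega>"
    using d by (simp_all add: r_def d_def cball_subset_domain[OF x])
  let ?V = "unit_ball_vol (real CARD('n)) * r ^ CARD('n)"
  have V: "0 < ?V"
    using r by simp
  have pointwise: "norm (gradient u y) \<le> B" if y: "y \<in> ball x r" for y
  proof -
    have y\<Omega>: "y \<in> \<Omega>"
      using y sub by auto
    have "r \<le> bdist \<Omega> y"
      using bdist_le[of \<Omega> x y] y r by (simp add: d_def[symmetric])
    then have "\<psi> (bdist \<Omega> y) / bdist \<Omega> y \<le> \<psi> r / r"
      by (rule majorant_ratio_antimono[OF \<psi> r(1)])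
    also have "\<psi> r / r \<le> \<psi> d / r"
      using majorant_mono[OF \<psi>, of r d] r by (intro divide_right_mono) auto
    also have "\<psi> d / r = 2 * (\<psi> d / d)"
      using r by simp
    finally have "C * (\<psi> (bdist \<Omega> y) / bdist \<Omega> y) \<le> C * (2 * (\<psi> d / d))"
      using C(1) by (intro mult_left_mono) auto
    also have "C * (2 * (\<psi> d / d)) = B"
      by (simp add: B_def)
    finally show ?thesis
      using C(2)[OF y\<Omega>] by linarith
  qed
  have "integral (ball x r) (\<lambda>y. norm (gradient u y) powr p) \<le> integral (ball x r) (\<lambda>y. B powr p)"
    using grad_mean_eq(2)[OF \<Omega> u p x] pointwise p
    by (intro integral_le powr_mono2) (auto simp: r_def d_def intro!: integrable_on_const)
  also have "\<dots> = B powr p * ?V"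
    using integral_ball_const[of r x "B powr p"] r by simp
  finally have "integral (ball x r) (\<lambda>y. norm (gradient u y) powr p) / ?V \<le> B powr p"
    using V by (simp add: pos_divide_le_eq)
  moreover have "0 \<le> integral (ball x r) (\<lambda>y. norm (gradient u y) powr p) / ?V"
    using V grad_mean_eq(2)[OF \<Omega> u p x]
    by (intro divide_nonneg_pos integral_nonneg) (auto simp: r_def d_def)
  ultimately have "(integral (ball x r) (\<lambda>y. norm (gradient u y) powr p) / ?V) powr (1 / p) \<le> (B powr p) powr (1 / p)"
    using p by (intro powr_mono2) auto
  also have "\<dots> = B"
    using p B by (simp add: powr_powr)
  finally show ?thesis
    using grad_mean_eq(1)[OF \<Omega> u p x] by (simp add: B_def r_def d_def)
qed

lemma gradient_le_grad_mean:
  fixes u :: "real ^ 'n::finite \<Rightarrow> real"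
  assumes \<Omega>: "proper_subdomain \<Omega>" and u: "harmonic_on \<Omega> u" and p: "0 < p"
  obtains K where "0 < K" and "\<And>x. x \<in> \<Omega> \<Longrightarrow> norm (gradient u x) \<le> K * grad_mean \<Omega> u p x"
proof -
  obtain K where K: "0 < K"
    and le: "\<And>x R. \<lbrakk>0 < R; cball x R \<subseteq> \<Omega>\<rbrakk>
      \<Longrightarrow> R ^ CARD('n) * norm (gradient u x) powr p \<le> K * integral (ball x R) (\<lambda>y. norm (gradient u y) powr p)"
    using gradient_powr_sub_mean_value[OF p, where ?'n = 'n] \<Omega> u unfolding proper_subdomain_def by metis
  define \<beta> where "\<beta> = unit_ball_vol (real CARD('n))"
  have \<beta>: "0 < \<beta>"
    by (simp add: \<beta>_def)
  have "norm (gradient u x) \<le> (K * \<beta>) powr (1 / p) * grad_mean \<Omega> u p x" if x: "x \<in> \<Omega>" for x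
  proof -
    define r where "r = bdist \<Omega> x / 2"
    have r: "0 < r" "cball x r \<subseteq> \<Omega>"
      using proper_subdomain_bdist_pos[OF \<Omega> x] by (simp_all add: r_def cball_subset_domain[OF x])
    let ?I = "integral (ball x r) (\<lambda>y. norm (gradient u y) powr p)"
    have "norm (gradient u x) powr p \<le> K * \<beta> * (?I / (\<beta> * r ^ CARD('n)))"
      using le[OF r] r(1) \<beta> by (simp add: field_simps)
    then have "(norm (gradient u x) powr p) powr (1 / p) \<le> (K * \<beta> * (?I / (\<beta> * r ^ CARD('n)))) powr (1 / p)"
      using p by (intro powr_mono2) auto
    also have "\<dots> = (K * \<beta>) powr (1 / p) * (?I / (\<beta> * r ^ CARD('n))) powr (1 / p)"
      by (rule powr_mult)
    also have "(?I / (\<beta> * r ^ CARD('n))) powr (1 / p) = grad_mean \<Omega> u p x"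
      using grad_mean_eq(1)[OF \<Omega> u p x] by (simp only: \<beta>_def r_def)
    finally show ?thesis
      using p by (simp add: powr_powr)
  qed
  then show thesis
    using K \<beta> by (intro that[of "(K * \<beta>) powr (1 / p)"]) auto
qed

section \<open>Equivalence of the five conditions\<close>
theorem theorem2p16:
  fixes \<psi> :: "real \<Rightarrow> real"
    and \<Omega> :: "(real ^ 'n::finite) set"
    and u :: "real ^ 'n \<Rightarrow> real"
    and p :: real
  assumes "CARD('n) \<ge> 2"
    and "fast_majorant \<psi>"
    and "extension_domain \<psi> \<Omega>"
    and "harmonic_on \<Omega> u"
    and "CARD('n) > 2 \<Longrightarrow> p \<ge> (real CARD('n) - 2) / (real CARD('n) - 1)"
    and "CARD('n) = 2 \<Longrightarrow> p > 0"
  defines "F1 \<equiv> u \<in> Lip \<psi> \<Omega>"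
    and "F2 \<equiv> \<exists>C>0. \<forall>x\<in>\<Omega>. norm (gradient u x) \<le> C * (\<psi> (bdist \<Omega> x) / bdist \<Omega> x)"
    and "F3 \<equiv> (\<lambda>x. \<bar>u x\<bar>) \<in> Lip \<psi> \<Omega>"
    and "F4 \<equiv> \<exists>F. (\<forall>x\<in>\<Omega>. F x = \<bar>u x\<bar>) \<and> F \<in> Lip2 \<psi> \<Omega> (frontier \<Omega>)"
    and "F5 \<equiv> \<exists>C>0. \<forall>x\<in>\<Omega>. grad_mean \<Omega> u p x \<le> C * (\<psi> (bdist \<Omega> x) / bdist \<Omega> x)"
  shows "(F1 \<longleftrightarrow> F2) \<and> (F1 \<longleftrightarrow> F3) \<and> (F1 \<longleftrightarrow> F4) \<and> (F1 \<longleftrightarrow> F5)"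
proof -
  have \<psi>: "majorant \<psi>"
    using assms(2) by (simp add: fast_majorant_def)
  have \<Omega>: "proper_subdomain \<Omega>"
    using assms(3) by (simp add: extension_domain_def)
  note u = assms(4)
  have p: "0 < p"
  proof (cases "CARD('n) = 2")
    case True
    then show ?thesis
      by (rule assms(6))
  next
    case False
    then have "CARD('n) > 2"
      using assms(1) by simp
    moreover from this have "0 < (real CARD('n) - 2) / (real CARD('n) - 1)"
      by simp
    ultimately show ?thesis
      using assms(5) by linarith
  qed
  have "F3" if "F1"
    using that unfolding F1_def F3_def by (rule Lip_abs)
  moreover have "F4" if "F3"
    using Lip_extends_to_frontier[OF \<psi> that[unfolded F3_def]] unfolding F4_def .
  moreover have "F2" if "F4"
  proof -
    obtain F where F: "\<And>x. x \<in> \<Omega> \<Longrightarrow> F x = \<bar>u x\<bar>" "F \<in> Lip2 \<psi> \<Omega> (frontier \<Omega>)"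
      using \<open>F4\<close> unfolding F4_def by blast
    obtain C where C: "0 < C"
      "\<And>x y. \<lbrakk>x \<in> \<Omega>; y \<in> cball x (bdist \<Omega> x / 2)\<rbrakk> \<Longrightarrow> norm (F y - F x) \<le> C * \<psi> (bdist \<Omega> x)"
      using Lip2_frontier_oscillation[OF \<psi> \<Omega> F(2)] by blast
    have "\<bar>\<bar>u y\<bar> - \<bar>u x\<bar>\<bar> \<le> C * \<psi> (bdist \<Omega> x)" if "x \<in> \<Omega>" "y \<in> cball x (bdist \<Omega> x / 2)" for x y
    proof -
      have "y \<in> \<Omega>"
        using cball_subset_domain[OF that(1), of "bdist \<Omega> x / 2"] proper_subdomain_bdist_pos[OF \<Omega> that(1)] that(2)
        by auto
      with C(2)[OF that] F(1) that(1) show ?thesis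
        by simp
    qed
    then show ?thesis
      unfolding F2_def by (rule abs_oscillation_imp_gradient_bound[OF \<Omega> u C(1)])
  qed
  moreover have "F1" if "F2"
    using that gradient_bound_imp_locLip[OF \<psi> \<Omega> u] extension_domain_real[OF assms(3)]
    unfolding F1_def F2_def by blast
  moreover have "F5" if "F2"
  proof -
    obtain C where C: "0 < C" "\<And>x. x \<in> \<Omega> \<Longrightarrow> norm (gradient u x) \<le> C * (\<psi> (bdist \<Omega> x) / bdist \<Omega> x)"
      using \<open>F2\<close> unfolding F2_def by blast
    show ?thesis
      unfolding F5_def using gradient_bound_imp_grad_mean_bound[OF \<psi> \<Omega> u p _ C] C(1)
      by (intro exI[of _ "2 * C"]) simp
  qed
  moreover have "F2" if "F5"
  proof -
    obtain C where C: "0 < C" "\<And>x. x \<in> \<Omega> \<Longrightarrow> grad_mean \<Omega> u p x \<le> C * (\<psi> (bdist \<Omega> x) / bdist \<Omega> x)"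
      using \<open>F5\<close> unfolding F5_def by blast
    obtain K where K: "0 < K" "\<And>x. x \<in> \<Omega> \<Longrightarrow> norm (gradient u x) \<le> K * grad_mean \<Omega> u p x"
      using gradient_le_grad_mean[OF \<Omega> u p] by blast
    have "norm (gradient u x) \<le> K * C * (\<psi> (bdist \<Omega> x) / bdist \<Omega> x)" if "x \<in> \<Omega>" for x
      using order_trans[OF K(2)[OF that] mult_left_mono[OF C(2)[OF that] less_imp_le[OF K(1)]]]
      by (simp add: mult.assoc)
    then show ?thesis
      unfolding F2_def using K(1) C(1) by (intro exI[of _ "K * C"]) simp
  qed
  ultimately show ?thesis
    by blast
qed

end
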